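(* For any linear-span randomized first-order algorithm $\mathcal{A}$ and any $L>0$, $\sigma>0$, integer $n\ge1$, $\Delta>0$ and $\epsilon>0$ with $\epsilon^2 \leq \min\{\Delta\sigma,\ L\Delta n^{-1/2}\}/10^5$, there exist a dimension $d = O\big(\frac{\Delta}{\epsilon^2}\min\{n^{3/4}\sqrt{\sigma L},\ \sqrt{n}L\}\big)$ and functions $f_1,\dots,f_n:\mathbb{R}^d \rightarrow \mathbb{R}$, with average $F=\frac1n\sum_{i=1}^n f_i$, which satisfy $\{f_i\}_{i=1}^n \in \mathcal{V}^{(L)}$, $F \in \mathcal{S}^{(-\sigma, L)}$ and $F(\mathbf{x}^{(0)}) - \inf_{\mathbf{x} \in \mathbb{R}^d} F(\mathbf{x}) \leq \Delta$, such that, in order to find $\hat{\mathbf{x}} \in \mathbb{R}^d$ with $\mathbb{E}\|\nabla F(\hat{\mathbf{x}})\|_2 \leq \epsilon$, $\mathcal{A}$ needs at least $$\Omega \bigg(\frac{\Delta}{\epsilon^2}\min\big\{n^{3/4}\sqrt{\sigma L},\ \sqrt{n}L\big\}\bigg)$$ IFO calls.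
   Context: $O(\cdot)$ and $\Omega(\cdot)$ hide universal multiplicative constants. Smoothness: for $l\in\mathbb{R}$, $L>0$, a differentiable $f:\mathbb{R}^m\to\mathbb{R}$ is $(l,L)$-smooth, written $f\in\mathcal{S}^{(l,L)}$, if for all $\mathbf{x},\mathbf{y}\in\mathbb{R}^m$, $\frac l2\|\mathbf{x}-\mathbf{y}\|_2^2\le f(\mathbf{x})-f(\mathbf{y})-\langle\nabla f(\mathbf{y}),\mathbf{x}-\mathbf{y}\rangle\le\frac L2\|\mathbf{x}-\mathbf{y}\|_2^2$. Average smoothness: differentiable functions $f_1,\dots,f_n:\mathbb{R}^m\to\mathbb{R}$ are $L$-average smooth, written $\{f_i\}_{i=1}^n\in\mathcal{V}^{(L)}$, if for all $\mathbf{x},\mathbf{y}$, $\frac1n\sum_{i=1}^n\|\nabla f_i(\mathbf{x})-\nabla f_i(\mathbf{y})\|_2^2\le L^2\|\mathbf{x}-\mathbf{y}\|_2^2$. Oracle: given $\mathbf{x}$ and $i\in[n]=\{1,\dots,n\}$, the Incremental First-order Oracle (IFO) returns $[f_i(\mathbf{x}),\nabla f_i(\mathbf{x})]$. Algorithm class: given an initial point $\mathbf{x}^{(0)}$, a linear-span randomized first-order algorithm $\mathcal{A}$ is a measurable mapping from functions $\{f_i\}_{i=1}^n$ to an infinite sequence of point and index pairs $\{(\mathbf{x}^{(t)},i_t)\}_{t=0}^\infty$ with random variables $i_t\in[n]$, satisfying $\mathbf{x}^{(t+1)}\in\mathrm{Lin}\{\mathbf{x}^{(0)},\dots,\mathbf{x}^{(t)},\nabla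 f_{i_0}(\mathbf{x}^{(0)}),\dots,\nabla f_{i_t}(\mathbf{x}^{(t)})\}$, where $\mathrm{Lin}$ denotes linear span. The algorithm is defined in every dimension $d$, with an initial point $\mathbf{x}^{(0)}\in\mathbb{R}^d$. Counting: one IFO call (at $\mathbf{x}^{(t)}$ with index $i_t$) is made per step, so $\mathbf{x}^{(t)}$ is the output after $t$ IFO calls. "$\mathcal{A}$ needs at least $N$ IFO calls to find $\hat{\mathbf{x}}$ with a given property" means that no output $\hat{\mathbf{x}}=\mathbf{x}^{(t)}$ with $t<N$ has the property. Expectation $\mathbb{E}$ is over the randomness of the algorithm. *)

theory Defs
  imports "HOL-Probability.Probability"
begin

text \<open>
  The dimension is existentially quantified in the theorem and an algorithm has to be defined in
  every dimension, so the Euclidean space of dimension \<open>d\<close> is not a type. It is the subspace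
  \<open>Rd d\<close> of the inner product space of finitely supported real sequences that consists of the
  sequences vanishing from index \<open>d\<close> on. A function on it is a total function whose values
  outside \<open>Rd d\<close> are never used.
\<close>

typedef rvec = "{x :: nat \<Rightarrow> real. finite {i. x i \<noteq> 0}}"
  morphisms coord vec_of
  by (rule exI[of _ "\<lambda>_. 0"]) simp

setup_lifting type_definition_rvec

instantiation rvec :: real_vector
begin

lift_definition zero_rvec :: rvec is "\<lambda>_. 0" by simp

lift_definition plus_rvec :: "rvec \<Rightarrow> rvec \<Rightarrow> rvec" is "\<lambda>x y i. x i + y i"
  by (erule rev_finite_subset[OF finite_UnI], assumption) auto

lift_definition minus_rvec :: "rvec \<Rightarrow> rvec \<Rightarrow> rvec" is "\<lambda>x y i. x i - y i"
  by (erule rev_finite_subset[OF finite_UnI], assumption) auto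

lift_definition uminus_rvec :: "rvec \<Rightarrow> rvec" is "\<lambda>x i. - x i"
  by simp

lift_definition scaleR_rvec :: "real \<Rightarrow> rvec \<Rightarrow> rvec" is "\<lambda>c x i. c * x i"
  by (erule rev_finite_subset) auto

instance
  by standard (transfer; simp add: fun_eq_iff algebra_simps)+

end

lemmas coord_simps [simp] =
  zero_rvec.rep_eq plus_rvec.rep_eq minus_rvec.rep_eq uminus_rvec.rep_eq scaleR_rvec.rep_eq

lemma finite_support [simp]: "finite {i. coord x i \<noteq> 0}"
  using coord[of x] by simp

lemma rvec_eqI: "(\<And>i. coord x i = coord y i) \<Longrightarrow> x = y"
  by (simp add: coord_inject[symmetric] fun_eq_iff)

instantiation rvec :: real_inner
begin

definition inner_rvec :: "rvec \<Rightarrow> rvec \<Rightarrow> real" where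
  "inner_rvec x y = (\<Sum>i | coord x i \<noteq> 0. coord x i * coord y i)"

definition norm_rvec :: "rvec \<Rightarrow> real" where
  "norm_rvec x = sqrt (inner x x)"

definition sgn_rvec :: "rvec \<Rightarrow> rvec" where
  "sgn_rvec x = x /\<^sub>R norm x"

definition dist_rvec :: "rvec \<Rightarrow> rvec \<Rightarrow> real" where
  "dist_rvec x y = norm (x - y)"

definition uniformity_rvec :: "(rvec \<times> rvec) filter" where
  "uniformity_rvec = (INF e\<in>{0<..}. principal {(x, y). dist x y < e})"

definition open_rvec :: "rvec set \<Rightarrow> bool" where
  "open_rvec U \<longleftrightarrow> (\<forall>x\<in>U. eventually (\<lambda>(x', y). x' = x \<longrightarrow> y \<in> U) uniformity)"

lemma inner_rvec_superset:
  assumes "finite A" "{i. coord x i \<noteq> 0} \<subseteq> A"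
  shows "inner x y = (\<Sum>i\<in>A. coord x i * coord y i)"
  unfolding inner_rvec_def using assms by (intro sum.mono_neutral_left) auto

instance
proof
  fix x y z :: rvec and r :: real
  let ?A = "{i. coord x i \<noteq> 0} \<union> {i. coord y i \<noteq> 0} \<union> {i. coord z i \<noteq> 0}"
  have fin: "finite ?A" by simp
  show "inner x y = inner y x"
    by (subst (1 2) inner_rvec_superset[OF fin]) (auto simp: mult.commute)
  show "inner (x + y) z = inner x z + inner y z"
    by (subst (1 2 3) inner_rvec_superset[OF fin]) (auto simp: algebra_simps sum.distrib)
  show "inner (r *\<^sub>R x) y = r * inner x y"
    by (subst (1 2) inner_rvec_superset[OF fin]) (auto simp: algebra_simps sum_distrib_left)
  show "0 \<le> inner x x"
    unfolding inner_rvec_def by (intro sum_nonneg) simp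
  show "inner x x = 0 \<longleftrightarrow> x = 0"
  proof
    assume "inner x x = 0"
    then have "\<forall>i\<in>{i. coord x i \<noteq> 0}. coord x i * coord x i = 0"
      unfolding inner_rvec_def by (subst (asm) sum_nonneg_eq_0_iff) auto
    then show "x = 0" by (intro rvec_eqI) auto
  next
    assume "x = 0"
    then show "inner x x = 0" by (simp add: inner_rvec_def)
  qed
  show "norm x = sqrt (inner x x)" by (rule norm_rvec_def)
qed (rule sgn_rvec_def dist_rvec_def uniformity_rvec_def open_rvec_def)+

end

definition Rd :: "nat \<Rightarrow> rvec set" where
  "Rd d = {x. \<forall>i\<ge>d. coord x i = 0}"

lemma inner_Rd: "x \<in> Rd d \<Longrightarrow> inner x y = (\<Sum>i<d. coord x i * coord y i)"
  by (rule inner_rvec_superset) (auto simp: Rd_def not_le[symmetric])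

lemma norm_Rd: "x \<in> Rd d \<Longrightarrow> norm x = sqrt (\<Sum>i<d. (coord x i)\<^sup>2)"
  by (simp add: norm_rvec_def inner_Rd power2_eq_square)

lemma subspace_Rd: "subspace (Rd d)"
  by (auto simp: subspace_def Rd_def)

definition has_grad :: "nat \<Rightarrow> (rvec \<Rightarrow> real) \<Rightarrow> rvec \<Rightarrow> rvec \<Rightarrow> bool" where
  "has_grad d f x g \<longleftrightarrow> g \<in> Rd d \<and> (f has_derivative (\<lambda>h. inner g h)) (at x within Rd d)"

definition grad :: "nat \<Rightarrow> (rvec \<Rightarrow> real) \<Rightarrow> rvec \<Rightarrow> rvec" where
  "grad d f x = (THE g. has_grad d f x g)"

lemma has_grad_unique:
  assumes x: "x \<in> Rd d" and g: "has_grad d f x g" and h: "has_grad d f x h"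
  shows "g = h"
proof (rule ccontr)
  assume ne: "g \<noteq> h"
  define v where "v = g - h"
  have v: "v \<in> Rd d" "v \<noteq> 0"
    using g h ne subspace_Rd[of d] by (auto simp: has_grad_def v_def subspace_diff)
  let ?p = "\<lambda>t::real. x + t *\<^sub>R v"
  have p: "(?p has_derivative (\<lambda>t. t *\<^sub>R v)) (at 0)"
    by (auto intro!: derivative_eq_intros)
  have im: "?p ` UNIV \<subseteq> Rd d"
    using x v subspace_Rd[of d] by (auto intro!: subspace_add subspace_scale)
  have comp: "((f \<circ> ?p) has_derivative (\<lambda>t. inner k (t *\<^sub>R v))) (at 0)" if "has_grad d f x k" for k
  proof -
    have "(f has_derivative inner k) (at (?p 0) within ?p ` UNIV)"
      using that im by (auto simp: has_grad_def intro: has_derivative_subset)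
    from diff_chain_within[OF p this] show ?thesis by (simp add: o_def)
  qed
  have "(\<lambda>t. inner g (t *\<^sub>R v)) = (\<lambda>t. inner h (t *\<^sub>R v))"
    by (rule has_derivative_unique[OF comp[OF g] comp[OF h]])
  then have "inner g (1 *\<^sub>R v) = inner h (1 *\<^sub>R v)" by (rule fun_cong)
  then have "inner v v = 0" by (simp add: v_def inner_diff_left)
  then show False using v by simp
qed

lemma grad_eqI: "x \<in> Rd d \<Longrightarrow> has_grad d f x g \<Longrightarrow> grad d f x = g"
  unfolding grad_def using has_grad_unique by blast

lemma sum_basis_Rd:
  assumes "x \<in> Rd d"
  shows "x = (\<Sum>i<d. coord x i *\<^sub>R vec_of (\<lambda>j. if j = i then 1 else 0))"
proof (rule rvec_eqI)
  fix j
  have *: "coord (vec_of (\<lambda>j. if j = i then 1 else 0)) j = (if j = i then 1 else 0)" for i j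
    by (subst vec_of_inverse) auto
  have sum: "coord (\<Sum>i\<in>A. u i) j = (\<Sum>i\<in>A. coord (u i) j)" for A and u :: "nat \<Rightarrow> rvec"
    by (induction A rule: infinite_finite_induct) auto
  show "coord x j = coord (\<Sum>i<d. coord x i *\<^sub>R vec_of (\<lambda>j. if j = i then 1 else 0)) j"
    using assms by (auto simp: sum * Rd_def if_distrib sum.delta cong: if_cong)
qed

lemma has_grad_grad:
  assumes f: "f differentiable_on Rd d" and x: "x \<in> Rd d"
  shows "has_grad d f x (grad d f x)"
proof -
  obtain D where D: "(f has_derivative D) (at x within Rd d)"
    using f x by (auto simp: differentiable_on_def differentiable_def)
  define e where "e i = vec_of (\<lambda>j. if j = i then 1 else 0)" for i :: nat
  have e: "coord (e i) j = (if j = i then 1 else 0)" for i j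
    unfolding e_def by (subst vec_of_inverse) auto
  define g where "g = (\<Sum>i<d. D (e i) *\<^sub>R e i)"
  have gR: "g \<in> Rd d"
    unfolding g_def by (intro subspace_sum subspace_scale subspace_Rd) (auto simp: Rd_def e)
  have Dg: "D h = inner g h" if h: "h \<in> Rd d" for h
  proof -
    have "D h = D (\<Sum>i<d. coord h i *\<^sub>R e i)"
      using sum_basis_Rd[OF h] by (simp add: e_def)
    also have "\<dots> = (\<Sum>i<d. coord h i * D (e i))"
      using has_derivative_linear[OF D] by (simp add: linear_sum linear_scale)
    also have "\<dots> = (\<Sum>i<d. D (e i) * inner (e i) h)"
    proof (rule sum.cong)
      fix i assume "i \<in> {..<d}"
      have "inner (e i) h = (\<Sum>j\<in>{i}. coord (e i) j * coord h j)"
        by (rule inner_rvec_superset) (auto simp: e)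
      then show "coord h i * D (e i) = D (e i) * inner (e i) h" by (simp add: e)
    qed simp
    also have "\<dots> = inner g h" by (simp add: g_def inner_sum_left)
    finally show ?thesis .
  qed
  have "(f has_derivative inner g) (at x within Rd d)"
    unfolding has_derivative_within
  proof (intro conjI)
    show "bounded_linear (inner g)" by (rule bounded_linear_inner_right)
    have "\<forall>\<^sub>F y in at x within Rd d. (1 / norm (y - x)) *\<^sub>R (f y - (f x + D (y - x))) =
            (1 / norm (y - x)) *\<^sub>R (f y - (f x + inner g (y - x)))"
      unfolding eventually_at_filter
      by (rule always_eventually) (auto simp: Dg subspace_diff[OF subspace_Rd] x)
    then show "((\<lambda>y. (1 / norm (y - x)) *\<^sub>R (f y - (f x + inner g (y - x)))) \<longlongrightarrow> 0)
        (at x within Rd d)"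
      using D by (auto simp: has_derivative_within elim: Lim_transform_eventually)
  qed
  then have "has_grad d f x g" using gR by (simp add: has_grad_def)
  then show ?thesis using grad_eqI[OF x] by simp
qed

definition smooth_class :: "nat \<Rightarrow> real \<Rightarrow> real \<Rightarrow> (rvec \<Rightarrow> real) set" where
  "smooth_class d l L = {f. f differentiable_on Rd d \<and>
     (\<forall>x\<in>Rd d. \<forall>y\<in>Rd d.
        l / 2 * (norm (x - y))\<^sup>2 \<le> f x - f y - inner (grad d f y) (x - y) \<and>
        f x - f y - inner (grad d f y) (x - y) \<le> L / 2 * (norm (x - y))\<^sup>2)}"

text \<open>A family of \<open>n\<close> functions is indexed by \<open>{1..n}\<close>; other indices are ignored.\<close>

definition average_smooth_class :: "nat \<Rightarrow> nat \<Rightarrow> real \<Rightarrow> (nat \<Rightarrow> rvec \<Rightarrow> real) set" where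
  "average_smooth_class d n L = {f. (\<forall>i\<in>{1..n}. f i differentiable_on Rd d) \<and>
     (\<forall>x\<in>Rd d. \<forall>y\<in>Rd d.
        1 / real n * (\<Sum>i=1..n. (norm (grad d (f i) x - grad d (f i) y))\<^sup>2)
          \<le> L\<^sup>2 * (norm (x - y))\<^sup>2)}"

definition average :: "nat \<Rightarrow> (nat \<Rightarrow> rvec \<Rightarrow> real) \<Rightarrow> rvec \<Rightarrow> real" where
  "average n f x = 1 / real n * (\<Sum>i=1..n. f i x)"

definition trajectories :: "nat \<Rightarrow> nat \<Rightarrow> (nat \<Rightarrow> rvec \<times> nat) measure" where
  "trajectories n d = (\<Pi>\<^sub>M t\<in>UNIV. restrict_space borel (Rd d) \<Otimes>\<^sub>M count_space {1..n})"

text \<open>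
  An algorithm for families of \<open>n\<close> functions. In each dimension \<open>d\<close> it has an initial point
  \<open>x0 d\<close> and maps a family \<open>f\<close> to a random trajectory, given by its law \<open>A d f\<close>; the random
  points and indices are the coordinates of the trajectory. Measurability in \<open>f\<close> refers to a
  sigma-algebra \<open>\<F> d\<close> on the families of differentiable functions, which is a parameter:
  no particular choice is distinguished. Since functions on \<open>Rd d\<close> are totalized, \<open>A\<close> may look at
  values outside \<open>Rd d\<close>, which only enlarges the class. The indices may depend on \<open>f\<close> in an
  arbitrary way; only the points are restricted, by the span condition.
\<close>

definition linear_span_algorithm ::
  "nat \<Rightarrow> (nat \<Rightarrow> rvec) \<Rightarrow> (nat \<Rightarrow> (nat \<Rightarrow> rvec \<Rightarrow> real) measure) \<Rightarrow>
   (nat \<Rightarrow> (nat \<Rightarrow> rvec \<Rightarrow> real) \<Rightarrow> (nat \<Rightarrow> rvec \<times> nat) measure) \<Rightarrow> bool" where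
  "linear_span_algorithm n x0 \<F> A \<longleftrightarrow> (\<forall>d\<ge>1.
     x0 d \<in> Rd d \<and>
     space (\<F> d) = {f. \<forall>i\<in>{1..n}. f i differentiable_on Rd d} \<and>
     A d \<in> \<F> d \<rightarrow>\<^sub>M prob_algebra (trajectories n d) \<and>
     (\<forall>f\<in>space (\<F> d). AE s in A d f.
        fst (s 0) = x0 d \<and>
        (\<forall>t. fst (s (Suc t)) \<in>
           span ((\<lambda>j. fst (s j)) ` {..t} \<union>
                 (\<lambda>j. grad d (f (snd (s j))) (fst (s j))) ` {..t}))))"

text \<open>
  The expectation is a nonnegative integral, so that a divergent expectation is infinite
  (and not 0, as with the Bochner integral).
\<close>

definition expected_grad_norm ::
  "nat \<Rightarrow> (rvec \<Rightarrow> real) \<Rightarrow> (nat \<Rightarrow> rvec \<times> nat) measure \<Rightarrow> nat \<Rightarrow> ennreal" where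
  "expected_grad_norm d F P t = (\<integral>\<^sup>+ s. ennreal (norm (grad d F (fst (s t)))) \<partial>P)"

text \<open>
  One oracle call is made per step, so the \<open>t\<close>-th point is the output after \<open>t\<close> calls.
\<close>

definition needs_at_least ::
  "nat \<Rightarrow> (rvec \<Rightarrow> real) \<Rightarrow> (nat \<Rightarrow> rvec \<times> nat) measure \<Rightarrow> real \<Rightarrow> real \<Rightarrow> bool" where
  "needs_at_least d F P \<epsilon> N \<longleftrightarrow>
     (\<forall>t. real t < N \<longrightarrow> \<not> expected_grad_norm d F P t \<le> ennreal \<epsilon>)"

definition complexity :: "nat \<Rightarrow> real \<Rightarrow> real \<Rightarrow> real \<Rightarrow> real \<Rightarrow> real" where
  "complexity n L \<sigma> \<Delta> \<epsilon> =
     \<Delta> / \<epsilon>\<^sup>2 * min (real n powr (3/4) * sqrt (\<sigma> * L)) (sqrt (real n) * L)"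

end

theory Submission
  imports Defs
begin

text \<open>
  Each \<open>f i\<close> is a \<^emph>\<open>zero chain\<close> in its own block of \<open>T\<close> orthonormal directions: as
  long as a point vanishes on the directions of block \<open>i\<close> from the \<open>r\<close>-th on, a gradient of \<open>f i\<close>
  reveals only the \<open>r\<close>-th of them. An algorithm that stays in the span of what it has seen therefore
  needs \<open>T\<close> calls to the index \<open>i\<close> before it can move along the last direction of block \<open>i\<close>
  (\<open>zero_chain_trajectory\<close>). After fewer than \<open>n T / 2\<close> calls half of the blocks are unfinished
  (\<open>many_rarely_called\<close>), and each of them contributes a gradient of fixed size, orthogonal to the others
  (\<open>norm_average_grad_large\<close>). This argument works on almost every single trajectory, so the
  family of functions depends on the algorithm only through its initial point.

  The function on a block is a chain in the style of Carmon, Duchi, Hinder and Sidford. With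
  \<open>\<theta> = 1 / p\<close>, \<open>\<alpha> = 8 / (p (p + 1))\<close> and \<open>y T = 0\<close> it is
  \<open>\<theta> / 2 (y 0 - 1)\<^sup>2 + 1 / 2 \<Sum>j<T. (y j - y (j + 1))\<^sup>2 + \<alpha> \<Sum>j<T. well (y j)\<close>,
  where \<open>well\<close> is a piecewise quadratic potential with minimum \<open>0\<close> at \<open>1\<close>. Its upper curvature
  is at most \<open>8\<close>, its lower curvature at most \<open>\<alpha>\<close>, and it starts at height
  \<open>\<theta> / 2 + \<alpha> T / 4\<close>. The main estimate is \<open>chain_grad_large\<close>: the squared norm of its gradient is at least
  \<open>1 / (72 p\<^sup>3)\<close> wherever the last entry is \<open>0\<close>, for every length \<open>T\<close>. It is proved by testing the
  gradient against a fixed sequence of weights, on which the discrete Laplacian is dominated by the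
  wells (\<open>sum_residual_bump\<close>).

  The parameters follow from the scaling. Since the blocks are orthogonal, the individual functions may have
  curvature \<open>sqrt n * L\<close> upwards and \<open>n * \<sigma>\<close> downwards, which determines \<open>p\<close>
  (\<open>parameter_choice\<close>) and the ratio of the vertical scale to the square of the horizontal scale;
  the required size of the gradient determines the horizontal scale, and the gap
  \<open>\<Delta>\<close> determines \<open>T\<close>. The product \<open>n T\<close> is then the claimed complexity up to a constant, and both the
  dimension \<open>n T + 1\<close> and the bound \<open>n T / 2\<close> on the number of calls are of this order.
  The initial point may be nonzero and is itself part of the span, so all blocks are chosen orthogonal to it (\<open>orthonormal_directions\<close>).
\<close>

section \<open>A potential with a flat critical point at the origin\<close>

text \<open>
  A potential with its minimum at \<open>1\<close> and one further critical point, \<open>0\<close>, where the slope vanishes without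
  changing sign. The critical point at \<open>0\<close> keeps the coordinates that an algorithm has not
  touched at \<open>0\<close>; the negative slope on both sides of it makes it costly to stay nearby. The slope
  has Lipschitz constant \<open>1\<close>, and it equals \<open>- \<bar>x\<bar>\<close> on the whole half-line \<open>x \<le> 1 / 2\<close>, which is
  what makes the gradient estimate below a linear computation.
\<close>
definition well :: "real \<Rightarrow> real" where
  "well x = (if x \<le> 0 then 1 / 4 + x\<^sup>2 / 2 else if x \<le> 1 / 2 then 1 / 4 - x\<^sup>2 / 2 else (x - 1)\<^sup>2 / 2)"

definition well_deriv :: "real \<Rightarrow> real" where
  "well_deriv x = max (- \<bar>x\<bar>) (x - 1)"

text \<open>
  This would follow from the Lipschitz bound for the slope and the mean value theorem. Comparing the
  quadratic pieces directly avoids differentiating at the two points where the pieces meet.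
\<close>
lemma well_remainder: "\<bar>well a - well b - well_deriv b * (a - b)\<bar> \<le> (a - b)\<^sup>2 / 2"
proof -
  \<comment> \<open>There are nine combinations of quadratic pieces. On each of them the claim follows linearly
    from the signs of the products that are listed in the three cases.\<close>
  consider "b \<le> 0" | "0 < b" "b \<le> 1/2" | "1/2 < b" by linarith
  then show ?thesis
  proof cases
    case 1
    then have d: "well_deriv b = b" "well b = 1/4 + b\<^sup>2/2" by (auto simp: well_deriv_def well_def)
    have "0 \<le> (a - b)\<^sup>2" "a > 0 \<Longrightarrow> a * b \<le> 0" "0 \<le> (a - 1/2)\<^sup>2" "0 \<le> b\<^sup>2"
      using 1 by (auto simp: mult_le_0_iff)
    then show ?thesis
      unfolding d unfolding well_def abs_le_iff
      by (auto simp: power2_eq_square algebra_simps add_divide_distrib diff_divide_distrib)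
        (insert zero_le_square[of b], linarith)+
  next
    case 2
    then have d: "well_deriv b = - b" "well b = 1/4 - b\<^sup>2/2" by (auto simp: well_deriv_def well_def)
    have "0 \<le> (a - b)\<^sup>2" "a \<le> 0 \<Longrightarrow> a * b \<le> 0" "0 \<le> (a - 1/2)\<^sup>2" "0 \<le> a\<^sup>2" "0 \<le> b\<^sup>2"
       "1/2 \<le> a \<Longrightarrow> (1/2 - b) * (a - 1/2) \<ge> 0" "0 \<le> (1/2 - b)\<^sup>2" "0 \<le> (a + b - 1/2)\<^sup>2" "0 \<le> (a + b)\<^sup>2"
       "a \<le> 0 \<Longrightarrow> a * (b - 1/2) \<ge> 0"  "1/2 \<le> a \<Longrightarrow> b * (a - 1/2) \<ge> 0"
      using 2 by (auto simp: mult_le_0_iff zero_le_mult_iff)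
    then show ?thesis using 2
      unfolding d unfolding well_def abs_le_iff
      by (auto simp: power2_eq_square algebra_simps add_divide_distrib diff_divide_distrib)
  next
    case 3
    then have d: "well_deriv b = b - 1" "well b = (b-1)\<^sup>2/2" by (auto simp: well_deriv_def well_def)
    have "0 \<le> (a - b)\<^sup>2" "a \<le> 0 \<Longrightarrow> a * (b-1/2) \<le> 0" "0 \<le> (a - 1/2)\<^sup>2" "0 \<le> a\<^sup>2" "0 \<le> b\<^sup>2"
       "a \<le> 1/2 \<Longrightarrow> (b - 1/2) * (1/2-a) \<ge> 0" "a \<le> 1/2 \<Longrightarrow> a \<ge> 0 \<Longrightarrow> a * (1/2-a) \<ge> 0"
       "0 \<le> (b - 1/2)\<^sup>2" 
      using 3 by (auto simp: mult_le_0_iff zero_le_mult_iff)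
    then show ?thesis using 3
      unfolding d unfolding well_def abs_le_iff
      by (auto simp: power2_eq_square algebra_simps add_divide_distrib diff_divide_distrib)
        (insert zero_le_square[of a], linarith)
  qed
qed

lemma well_nonneg: "0 \<le> well x"
proof (cases "0 < x \<and> x \<le> 1/2")
  case True
  then have "x\<^sup>2 \<le> (1/2)\<^sup>2" by (intro power_mono) auto
  then show ?thesis using True by (auto simp: well_def power2_eq_square)
qed (auto simp: well_def)

lemma well_deriv_lipschitz: "\<bar>well_deriv a - well_deriv b\<bar> \<le> \<bar>a - b\<bar>"
  by (auto simp: well_deriv_def max_def abs_if)

lemma well_deriv_neg: "x \<le> 1/2 \<Longrightarrow> well_deriv x = - \<bar>x\<bar>"
  by (auto simp: well_deriv_def)

section \<open>Test weights\<close>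

text \<open>
  The weights against which the gradient of the chain is tested. They play the role that
  \<open>sin (\<omega> t)\<close>, continued by a decaying exponential, plays for the differential equation
  \<open>x'' = - \<omega>\<^sup>2 \<bar>x\<bar>\<close>: positive, vanishing at \<open>0\<close>, square summable, and with a second
  difference dominated by the function itself. A rational function has these properties exactly
  in the discrete setting.
\<close>
definition bump :: "real \<Rightarrow> real \<Rightarrow> real" where
  "bump M t = t / (M + t\<^sup>2)"

text \<open>
  The quotient of the second difference by \<open>bump M t\<close> is an explicit rational function of \<open>t\<^sup>2\<close>,
  and it is of order \<open>1 / M\<close> because the product of the neighbouring denominators is
  \<open>M\<^sup>2 + 2 M (t\<^sup>2 + 1) + (t\<^sup>2 - 1)\<^sup>2\<close>.
\<close>
lemma bump_second_difference:
  assumes "1 \<le> M" "0 \<le> t"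
  shows "\<bar>bump M (t + 1) + bump M (t - 1) - 2 * bump M t\<bar> \<le> 8 / M * bump M t"
proof -
  let ?D = "(M + (t + 1)\<^sup>2) * (M + (t - 1)\<^sup>2)"
  have pos: "M + (t + 1)\<^sup>2 > 0" "M + (t - 1)\<^sup>2 > 0" "M + t\<^sup>2 > 0"
    using assms by (auto intro: add_pos_nonneg)
  have "bump M (t + 1) + bump M (t - 1) - 2 * bump M t
      = (2 * (t\<^sup>2 - 3 * M - 1) / ?D) * bump M t"
    unfolding bump_def using pos
    by (simp add: divide_simps) (simp add: power2_eq_square algebra_simps)
  then have "\<bar>bump M (t + 1) + bump M (t - 1) - 2 * bump M t\<bar>
      = \<bar>2 * (t\<^sup>2 - 3 * M - 1) / ?D\<bar> * bump M t"
    using assms by (simp add: abs_mult bump_def)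
  also have "\<dots> \<le> 8 / M * bump M t"
  proof (rule mult_right_mono)
    have D: "?D = M * M + 2 * M * (t\<^sup>2 + 1) + (t\<^sup>2 - 1)\<^sup>2"
      by (simp add: power2_eq_square algebra_simps)
    have "\<bar>2 * (t\<^sup>2 - 3 * M - 1)\<bar> \<le> 2 * t\<^sup>2 + 8 * M"
      using assms by (smt (verit, best) zero_le_power2)
    then have "M * \<bar>2 * (t\<^sup>2 - 3 * M - 1)\<bar> \<le> M * (2 * t\<^sup>2 + 8 * M)"
      using assms by (intro mult_left_mono) auto
    also have "\<dots> \<le> 8 * ?D"
      unfolding D using assms by (simp add: algebra_simps)
    finally have "M * \<bar>2 * (t\<^sup>2 - 3 * M - 1)\<bar> \<le> 8 * ?D" .
    then show "\<bar>2 * (t\<^sup>2 - 3 * M - 1) / ?D\<bar> \<le> 8 / M"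
      using pos assms by (simp add: abs_divide abs_mult divide_simps mult.commute)
    show "0 \<le> bump M t" using assms by (simp add: bump_def)
  qed
  finally show ?thesis .
qed

text \<open>
  Each square is at most \<open>1 / (p\<^sup>2 + t\<^sup>2)\<close>, hence at most \<open>2 / ((p + t - 1) (p + t))\<close>, which telescopes.
\<close>
lemma sum_bump_squared:
  assumes "1 \<le> p" "p\<^sup>2 \<le> M" "0 \<le> q"
  shows "(\<Sum>j<m. (bump M (q + 1 + real j))\<^sup>2) \<le> 2 / p"
proof -
  have step: "(bump M t)\<^sup>2 \<le> 2 / (p + t - 1) - 2 / (p + t)" if t: "1 \<le> t" for t
  proof -
    have M: "M > 0" using assms by (smt (verit) one_le_power)
    have "(bump M t)\<^sup>2 = t\<^sup>2 / (M + t\<^sup>2) * (1 / (M + t\<^sup>2))"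
      by (simp add: bump_def power2_eq_square)
    also have "\<dots> \<le> 1 * (1 / (M + t\<^sup>2))"
      using M by (intro mult_right_mono) (auto simp: divide_simps add_pos_nonneg)
    also have "\<dots> \<le> 1 / (p\<^sup>2 + t\<^sup>2)"
      using assms t by (auto intro!: divide_left_mono mult_pos_pos add_pos_pos add_pos_nonneg M)
    also have "\<dots> \<le> 2 / ((p + t - 1) * (p + t))"
    proof -
      have "(p + t - 1) * (p + t) \<le> 2 * (p\<^sup>2 + t\<^sup>2)"
        using assms t zero_le_power2[of "p - t"] by (simp add: power2_eq_square algebra_simps)
      moreover have "0 < (p + t - 1) * (p + t)" using assms t by simp
      moreover have "0 < p\<^sup>2 + t\<^sup>2" using t by (simp add: add_nonneg_pos)
      ultimately show ?thesis by (simp add: divide_simps)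
    qed
    also have "\<dots> = 2 / (p + t - 1) - 2 / (p + t)"
      using assms t by (simp add: divide_simps)
    finally show ?thesis .
  qed
  have "(\<Sum>j<m. (bump M (q + 1 + real j))\<^sup>2) \<le> 2 / (p + q) - 2 / (p + q + real m)"
  proof (induction m)
    case (Suc m)
    then show ?case using step[of "q + 1 + real m"] assms by (simp add: algebra_simps)
  qed simp
  also have "\<dots> \<le> 2 / p"
  proof -
    have "2 / (p + q) \<le> 2 / p" using assms by (intro divide_left_mono) auto
    moreover have "0 \<le> 2 / (p + q + real m)" using assms by simp
    ultimately show ?thesis by linarith
  qed
  finally show ?thesis .
qed

text \<open>
  Two summations by parts move the second difference from \<open>Y\<close> to the weights, where it is at most
  \<open>8 / M\<close> times the weight. For \<open>Y \<le> 1 / 2\<close> the slope of the well is \<open>- \<bar>Y\<bar>\<close>, so it absorbs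
  the resulting term whatever the signs are, and only the boundary terms remain.
\<close>
lemma sum_residual_bump:
  fixes Y :: "nat \<Rightarrow> real"
  assumes M: "1 \<le> M" and q: "0 \<le> q"
    and le: "\<And>j. j < m \<Longrightarrow> Y (k + 1 + j) \<le> 1 / 2"
  shows "(\<Sum>j<m. (2 * Y (k + 1 + j) - Y (k + j) - Y (k + 2 + j) + 8 / M * well_deriv (Y (k + 1 + j)))
            * bump M (q + 1 + real j))
    \<le> Y (k + 1) * bump M q - Y k * bump M (q + 1)
       + Y (k + m) * bump M (q + 1 + real m) - Y (k + 1 + m) * bump M (q + real m)"
  using le
proof (induction m)
  case (Suc m)
  let ?t = "q + 1 + real m" and ?y = "Y (k + 1 + m)"
  let ?D = "bump M (?t + 1) + bump M (?t - 1) - 2 * bump M ?t"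
  have "\<bar>?D\<bar> \<le> 8 / M * bump M ?t"
    by (rule bump_second_difference) (use M q in auto)
  then have "\<bar>?y\<bar> * \<bar>?D\<bar> \<le> \<bar>?y\<bar> * (8 / M * bump M ?t)"
    by (rule mult_left_mono) simp
  moreover have "- (?y * ?D) \<le> \<bar>?y\<bar> * \<bar>?D\<bar>"
    using abs_ge_minus_self[of "?y * ?D"] by (simp only: abs_mult)
  moreover have "well_deriv ?y = - \<bar>?y\<bar>"
    using Suc.prems[of m] by (intro well_deriv_neg) simp
  ultimately have key: "- (?y * ?D) + 8 / M * well_deriv ?y * bump M ?t \<le> 0"
    by (simp add: algebra_simps)
  have "(\<Sum>j<m. (2 * Y (k + 1 + j) - Y (k + j) - Y (k + 2 + j) + 8 / M * well_deriv (Y (k + 1 + j)))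
            * bump M (q + 1 + real j))
    \<le> Y (k + 1) * bump M q - Y k * bump M (q + 1)
       + Y (k + m) * bump M (q + 1 + real m) - Y (k + 1 + m) * bump M (q + real m)"
    by (rule Suc.IH) (use Suc.prems in simp)
  with key show ?case by (simp add: algebra_simps)
qed simp

section \<open>The elastic chain\<close>

text \<open>
  The elastic chain ties \<open>y 0\<close> weakly to the value \<open>1\<close>, every entry to its successor, and the last
  entry \<open>y (T - 1)\<close> to \<open>y T\<close>. The vectors of interest have \<open>y T = 0\<close>, so the far end is fixed at \<open>0\<close>,
  while every entry is drawn to \<open>1\<close> by its well.
\<close>
definition chain :: "real \<Rightarrow> real \<Rightarrow> nat \<Rightarrow> (nat \<Rightarrow> real) \<Rightarrow> real" where
  "chain \<theta> \<alpha> T y = \<theta> / 2 * (y 0 - 1)\<^sup>2 + (\<Sum>j<T. (y j - y (Suc j))\<^sup>2) / 2 + \<alpha> * (\<Sum>j<T. well (y j))"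

definition chain_grad :: "real \<Rightarrow> real \<Rightarrow> (nat \<Rightarrow> real) \<Rightarrow> nat \<Rightarrow> real" where
  "chain_grad \<theta> \<alpha> y j = (if j = 0 then \<theta> * (y 0 - 1) else y j - y (j - 1)) + (y j - y (Suc j))
     + \<alpha> * well_deriv (y j)"

lemma chain_nonneg: "0 \<le> \<theta> \<Longrightarrow> 0 \<le> \<alpha> \<Longrightarrow> 0 \<le> chain \<theta> \<alpha> T y"
  unfolding chain_def by (intro add_nonneg_nonneg mult_nonneg_nonneg divide_nonneg_nonneg sum_nonneg well_nonneg) auto

lemma chain_zero: "chain \<theta> \<alpha> T (\<lambda>_. 0) = \<theta> / 2 + \<alpha> * real T / 4"
  by (simp add: chain_def well_def)

lemma sum_by_parts:
  fixes b z :: "nat \<Rightarrow> real"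
  shows "(\<Sum>j<T. (b j - b (Suc j)) * (z j - z (Suc j)))
    = (\<Sum>j<T. ((if j = 0 then 0 else b j - b (j - 1)) + (b j - b (Suc j))) * z j)
      - (if T = 0 then 0 else (b (T - 1) - b T) * z T)"
  by (induction T) (auto simp: algebra_simps)

lemma sum_shift: "(\<Sum>j<T. f (Suc j)) = (\<Sum>j<T. f j) + f T - (f 0 :: real)"
  by (induction T) auto

text \<open>
  The elastic part is quadratic, so its remainder is its purely quadratic part at \<open>a - b\<close>;
  only the wells contribute a term that depends on \<open>b\<close>.
\<close>
lemma chain_remainder:
  assumes "0 < T" "a T = 0" "b T = 0"
  shows "chain \<theta> \<alpha> T a - chain \<theta> \<alpha> T b - (\<Sum>j<T. chain_grad \<theta> \<alpha> b j * (a j - b j))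
    = \<theta> / 2 * (a 0 - b 0)\<^sup>2 + (\<Sum>j<T. ((a j - b j) - (a (Suc j) - b (Suc j)))\<^sup>2) / 2
      + \<alpha> * (\<Sum>j<T. well (a j) - well (b j) - well_deriv (b j) * (a j - b j))"
proof -
  define z where "z j = a j - b j" for j
  have a: "a j = b j + z j" for j by (simp add: z_def)
  have zT: "z T = 0" using assms by (simp add: z_def)
  have "(\<Sum>j<T. chain_grad \<theta> \<alpha> b j * z j)
      = (\<Sum>j<T. (if j = 0 then \<theta> * (b 0 - 1) * z 0 else 0)
          + ((if j = 0 then 0 else b j - b (j - 1)) + (b j - b (Suc j))) * z j
          + \<alpha> * (well_deriv (b j) * z j))"
    by (rule sum.cong) (auto simp: chain_grad_def algebra_simps)
  also have "\<dots> = \<theta> * (b 0 - 1) * z 0 + (\<Sum>j<T. (b j - b (Suc j)) * (z j - z (Suc j)))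
      + \<alpha> * (\<Sum>j<T. well_deriv (b j) * z j)"
    using assms(1) zT by (simp add: sum.distrib sum_by_parts sum_distrib_left)
  finally have g: "(\<Sum>j<T. chain_grad \<theta> \<alpha> b j * z j) = \<dots>" .
  have q: "(\<Sum>j<T. (a j - a (Suc j))\<^sup>2) = (\<Sum>j<T. (b j - b (Suc j))\<^sup>2)
     + 2 * (\<Sum>j<T. (b j - b (Suc j)) * (z j - z (Suc j))) + (\<Sum>j<T. (z j - z (Suc j))\<^sup>2)"
    by (simp add: a sum_distrib_left sum.distrib[symmetric] power2_eq_square algebra_simps)
  have h: "(a 0 - 1)\<^sup>2 = (b 0 - 1)\<^sup>2 + 2 * (b 0 - 1) * z 0 + (z 0)\<^sup>2"
    by (simp add: a power2_eq_square algebra_simps)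
  have alg: "\<theta> / 2 * (B + 2 * c * x + Z) + (QB + 2 * P + QZ) / 2 + \<alpha> * WA - (\<theta> / 2 * B + QB / 2 + \<alpha> * WB)
      - (\<theta> * c * x + P + \<alpha> * D) = \<theta> / 2 * Z + QZ / 2 + \<alpha> * (WA - WB - D)" for B c x Z QB P QZ WA WB D
    by (simp add: field_simps)
  show ?thesis
    unfolding z_def[symmetric] g unfolding chain_def q h sum_subtractf by (rule alg)
qed

text \<open>
  The lower curvature comes from the wells alone and therefore scales with \<open>\<alpha>\<close>. To the upper
  curvature \<open>8\<close> the elastic part contributes \<open>4\<close> and the wells \<open>\<alpha> \<le> 4\<close>.
\<close>
lemma chain_remainder_bounds:
  assumes T: "0 < T" "a T = 0" "b T = 0" and \<theta>: "0 \<le> \<theta>" "\<theta> \<le> 1" and \<alpha>: "0 \<le> \<alpha>" "\<alpha> \<le> 4"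
  shows "- \<alpha> / 2 * (\<Sum>j<T. (a j - b j)\<^sup>2)
      \<le> chain \<theta> \<alpha> T a - chain \<theta> \<alpha> T b - (\<Sum>j<T. chain_grad \<theta> \<alpha> b j * (a j - b j))"
    and "chain \<theta> \<alpha> T a - chain \<theta> \<alpha> T b - (\<Sum>j<T. chain_grad \<theta> \<alpha> b j * (a j - b j))
      \<le> 4 * (\<Sum>j<T. (a j - b j)\<^sup>2)"
proof -
  define z where "z j = a j - b j" for j
  have zT: "z T = 0" using T by (simp add: z_def)
  let ?S = "\<Sum>j<T. (z j)\<^sup>2" and ?Q = "\<Sum>j<T. (z j - z (Suc j))\<^sup>2"
  let ?W = "\<Sum>j<T. well (a j) - well (b j) - well_deriv (b j) * (a j - b j)"
  have "\<bar>?W\<bar> \<le> (\<Sum>j<T. (z j)\<^sup>2 / 2)"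
    unfolding z_def by (rule order_trans[OF sum_abs sum_mono[OF well_remainder]])
  then have W: "\<bar>?W\<bar> \<le> ?S / 2" by (simp add: sum_divide_distrib)
  have "\<bar>\<alpha> * ?W\<bar> \<le> \<alpha> * (?S / 2)"
    unfolding abs_mult using \<alpha> by (intro mult_mono W) auto
  moreover have "\<alpha> * (?S / 2) \<le> 4 * (?S / 2)"
    using \<alpha> by (intro mult_right_mono) (auto simp: sum_nonneg)
  ultimately have W: "\<bar>\<alpha> * ?W\<bar> \<le> \<alpha> / 2 * ?S" "\<alpha> * ?W \<le> 2 * ?S" by auto
  have Q: "0 \<le> ?Q" by (intro sum_nonneg) auto
  have \<theta>z: "0 \<le> \<theta> * (z 0)\<^sup>2" "\<theta> * (z 0)\<^sup>2 \<le> 1 * (z 0)\<^sup>2"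
    using \<theta> by (simp, intro mult_right_mono) auto
  have "?Q \<le> (\<Sum>j<T. 2 * (z j)\<^sup>2 + 2 * (z (Suc j))\<^sup>2)"
  proof (rule sum_mono)
    fix j
    show "(z j - z (Suc j))\<^sup>2 \<le> 2 * (z j)\<^sup>2 + 2 * (z (Suc j))\<^sup>2"
      using zero_le_power2[of "z j + z (Suc j)"] by (simp add: power2_eq_square algebra_simps)
  qed
  also have "\<dots> = 2 * ?S + 2 * (\<Sum>j<T. (z (Suc j))\<^sup>2)"
    by (simp add: sum.distrib sum_distrib_left)
  also have "\<dots> = 4 * ?S - 2 * (z 0)\<^sup>2"
    using sum_shift[of "\<lambda>j. (z j)\<^sup>2" T] zT by simp
  finally have Q2: "?Q \<le> 4 * ?S - 2 * (z 0)\<^sup>2" .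
  note R = chain_remainder[of T a b \<theta> \<alpha>, OF T, folded z_def]
  show "- \<alpha> / 2 * (\<Sum>j<T. (a j - b j)\<^sup>2)
      \<le> chain \<theta> \<alpha> T a - chain \<theta> \<alpha> T b - (\<Sum>j<T. chain_grad \<theta> \<alpha> b j * (a j - b j))"
    using R W(1) Q \<theta>z(1) unfolding z_def by (simp add: abs_le_iff)
  show "chain \<theta> \<alpha> T a - chain \<theta> \<alpha> T b - (\<Sum>j<T. chain_grad \<theta> \<alpha> b j * (a j - b j))
      \<le> 4 * (\<Sum>j<T. (a j - b j)\<^sup>2)"
    using R W(2) Q2 \<theta>z(2) zero_le_power2[of "z 0"] unfolding z_def by linarith
qed

lemma chain_grad_lipschitz:
  assumes T: "a T = 0" "b T = 0" and \<theta>: "0 \<le> \<theta>" "\<theta> \<le> 1" and \<alpha>: "0 \<le> \<alpha>" "\<alpha> \<le> 4"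
  shows "(\<Sum>j<T. (chain_grad \<theta> \<alpha> a j - chain_grad \<theta> \<alpha> b j)\<^sup>2) \<le> 64 * (\<Sum>j<T. (a j - b j)\<^sup>2)"
proof -
  define z where "z j = a j - b j" for j
  define l where "l j = (if j = 0 then 0 else z (j - 1))" for j
  have zT: "z T = 0" using T by (simp add: z_def)
  let ?S = "\<Sum>j<T. (z j)\<^sup>2"
  have "(chain_grad \<theta> \<alpha> a j - chain_grad \<theta> \<alpha> b j)\<^sup>2 \<le> 8 * (6 * (z j)\<^sup>2 + (l j)\<^sup>2 + (z (Suc j))\<^sup>2)" for j
  proof -
    define w where "w = (if j = 0 then 1 + \<theta> else 2)"
    define e where "e = well_deriv (a j) - well_deriv (b j)"
    have "chain_grad \<theta> \<alpha> a j - chain_grad \<theta> \<alpha> b j = w * z j + \<alpha> * e - l j - z (Suc j)"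
      by (simp add: chain_grad_def w_def e_def l_def z_def algebra_simps)
    moreover have "\<bar>w * z j\<bar> \<le> 2 * \<bar>z j\<bar>"
      unfolding abs_mult by (intro mult_right_mono) (use \<theta> in \<open>auto simp: w_def\<close>)
    moreover have "\<bar>\<alpha> * e\<bar> \<le> 4 * \<bar>z j\<bar>"
      unfolding abs_mult using \<alpha> well_deriv_lipschitz[of "a j" "b j"]
      by (intro mult_mono) (auto simp: e_def z_def)
    ultimately have "\<bar>chain_grad \<theta> \<alpha> a j - chain_grad \<theta> \<alpha> b j\<bar> \<le> 6 * \<bar>z j\<bar> + \<bar>l j\<bar> + \<bar>z (Suc j)\<bar>"
      by linarith
    then have "(chain_grad \<theta> \<alpha> a j - chain_grad \<theta> \<alpha> b j)\<^sup>2 \<le> (6 * \<bar>z j\<bar> + \<bar>l j\<bar> + \<bar>z (Suc j)\<bar>)\<^sup>2"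
      by (metis abs_ge_zero power2_abs power_mono)
    also have "\<dots> \<le> 8 * (6 * \<bar>z j\<bar>\<^sup>2 + \<bar>l j\<bar>\<^sup>2 + \<bar>z (Suc j)\<bar>\<^sup>2)"
    proof -
      have "8 * (6 * u\<^sup>2 + v\<^sup>2 + w\<^sup>2) - (6 * u + v + w)\<^sup>2
          = 6 * (u - v)\<^sup>2 + 6 * (u - w)\<^sup>2 + (v - w)\<^sup>2" for u v w :: real
        by (simp add: power2_eq_square algebra_simps)
      moreover have "0 \<le> 6 * (u - v)\<^sup>2 + 6 * (u - w)\<^sup>2 + (v - w)\<^sup>2" for u v w :: real
        by simp
      ultimately show ?thesis by (metis diff_ge_0_iff_ge)
    qed
    finally show ?thesis by simp
  qed
  then have "(\<Sum>j<T. (chain_grad \<theta> \<alpha> a j - chain_grad \<theta> \<alpha> b j)\<^sup>2)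
      \<le> (\<Sum>j<T. 8 * (6 * (z j)\<^sup>2 + (l j)\<^sup>2 + (z (Suc j))\<^sup>2))"
    by (intro sum_mono) auto
  also have "\<dots> = 8 * (6 * ?S + (\<Sum>j<T. (l j)\<^sup>2) + (\<Sum>j<T. (z (Suc j))\<^sup>2))"
    by (simp add: sum.distrib sum_distrib_left)
  also have "\<dots> \<le> 8 * (6 * ?S + ?S + ?S)"
  proof -
    have "(\<Sum>j<T. (l j)\<^sup>2) \<le> ?S"
    proof (cases T)
      case (Suc m)
      then have "(\<Sum>j<T. (l j)\<^sup>2) = (\<Sum>j<m. (z j)\<^sup>2)"
        by (simp add: sum.lessThan_Suc_shift l_def del: sum.lessThan_Suc)
      then show ?thesis using Suc by simp
    qed simp
    moreover have "(\<Sum>j<T. (z (Suc j))\<^sup>2) \<le> ?S"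
      using sum_shift[of "\<lambda>j. (z j)\<^sup>2" T] zT by simp
    ultimately show ?thesis by simp
  qed
  finally show ?thesis by (simp add: z_def)
qed

lemma chain_grad_zero_chain:
  assumes "\<And>j. r \<le> j \<Longrightarrow> y j = 0" "r < j"
  shows "chain_grad \<theta> \<alpha> y j = 0"
  using assms by (simp add: chain_grad_def well_deriv_def)

text \<open>
  A chain that has not been moved at its last entry has to descend from about \<open>1\<close> to \<open>0\<close> somewhere,
  and the wells push against every way to do so. Let \<open>k\<close> be the last position with a value of at
  least \<open>1 / 2\<close>. Testing the gradient to the right of \<open>k\<close> against \<open>bump\<close> leaves only the boundary term at \<open>k\<close>,
  which is of order \<open>- 1 / p\<^sup>2\<close>, while the weights have norm of order \<open>p powr (- 1/2)\<close>; the
  inequality of Cauchy and Schwarz then gives a gradient of order \<open>p powr (- 3/2)\<close>. If there is no such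
  position, the weak spring at the front is stretched. Then the weights start at their peak, with
  \<open>bump M p = bump M (p + 1)\<close> for \<open>M = p (p + 1)\<close>, so that the boundary term is this weight times
  the force of the spring.
\<close>
lemma chain_grad_large:
  assumes p: "1 \<le> p" and T: "0 < T" "y (T - 1) = 0" "y T = 0"
  shows "1 / (72 * p ^ 3) \<le> (\<Sum>j<T. (chain_grad (1 / p) (8 / (p * (p + 1))) y j)\<^sup>2)"
proof -
  define M where "M = p * (p + 1)"
  define g where "g = chain_grad (1 / p) (8 / M) y"
  \<comment> \<open>Node \<open>0\<close> is fictitious, placed so that the spring to \<open>1\<close> acts like a unit spring to this node.
    Every entry of the gradient then has the same form \<open>gY\<close>.\<close>
  define Y where "Y i = (case i of 0 \<Rightarrow> y 0 + 1 / p * (1 - y 0) | Suc j \<Rightarrow> y j)" for i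
  have pp: "1 * p \<le> p * p" using p by (intro mult_right_mono) auto
  then have M: "1 \<le> M" "p\<^sup>2 \<le> M" "M + 1 \<le> 3 * p\<^sup>2"
    unfolding M_def power2_eq_square distrib_left using p by linarith+
  have gY: "g i = 2 * Y (i + 1) - Y i - Y (i + 2) + 8 / M * well_deriv (Y (i + 1))" for i
    by (cases i) (auto simp: g_def chain_grad_def Y_def algebra_simps)
  have YT: "Y T = 0" "Y (T + 1) = 0" using T by (auto simp: Y_def split: nat.split)
  \<comment> \<open>The common part of both cases: \<open>k\<close> is the node where the test starts, \<open>q\<close> the offset of the weights.
    The boundary terms at the far end vanish by \<open>YT\<close>.\<close>
  have *: "1 / (72 * p ^ 3) \<le> (\<Sum>j<T. (g j)\<^sup>2)"
    if k: "k \<le> T" "\<And>i. k < i \<Longrightarrow> i \<le> T \<Longrightarrow> Y i \<le> 1 / 2" and q: "0 \<le> q"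
      and c: "Y (k + 1) * bump M q - Y k * bump M (q + 1) \<le> - (1 / (6 * p\<^sup>2))" for k q
  proof -
    define m where "m = T - k"
    let ?v = "\<lambda>j. bump M (q + 1 + real j)"
    have m: "k + m = T" "k + 1 + m = T + 1" using k by (auto simp: m_def)
    have "(\<Sum>j<m. (2 * Y (k + 1 + j) - Y (k + j) - Y (k + 2 + j) + 8 / M * well_deriv (Y (k + 1 + j)))
            * ?v j)
        \<le> Y (k + 1) * bump M q - Y k * bump M (q + 1)
       + Y (k + m) * bump M (q + 1 + real m) - Y (k + 1 + m) * bump M (q + real m)"
      by (rule sum_residual_bump[OF M(1) q]) (use k m in auto)
    also have "\<dots> \<le> - (1 / (6 * p\<^sup>2))" using c by (simp only: m YT)
    finally have "(\<Sum>j<m. g (k + j) * ?v j) \<le> - (1 / (6 * p\<^sup>2))"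
      by (simp add: gY add.assoc add.commute)
    then have "(1 / (6 * p\<^sup>2))\<^sup>2 \<le> (- (\<Sum>j<m. g (k + j) * ?v j))\<^sup>2"
      by (intro power_mono) auto
    also have "\<dots> = (\<Sum>j<m. g (k + j) * ?v j)\<^sup>2" by simp
    also have "\<dots> \<le> (\<Sum>j<m. (g (k + j))\<^sup>2) * (\<Sum>j<m. (?v j)\<^sup>2)"
      by (rule Cauchy_Schwarz_ineq_sum)
    also have "\<dots> \<le> (\<Sum>j<T. (g j)\<^sup>2) * (2 / p)"
    proof (rule mult_mono)
      have "(\<Sum>j<m. (g (k + j))\<^sup>2) = (\<Sum>j\<in>(\<lambda>j. k + j) ` {..<m}. (g j)\<^sup>2)"
        by (simp add: sum.reindex)
      also have "\<dots> \<le> (\<Sum>j<T. (g j)\<^sup>2)"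
        using m by (intro sum_mono2) auto
      finally show "(\<Sum>j<m. (g (k + j))\<^sup>2) \<le> (\<Sum>j<T. (g j)\<^sup>2)" .
      show "(\<Sum>j<m. (?v j)\<^sup>2) \<le> 2 / p" by (rule sum_bump_squared[OF p M(2) q])
    qed (auto simp: sum_nonneg)
    finally have "(1 / (6 * p\<^sup>2))\<^sup>2 * (p / 2) \<le> (\<Sum>j<T. (g j)\<^sup>2) * (2 / p) * (p / 2)"
      using p by (intro mult_right_mono) auto
    moreover have "(1 / (6 * p\<^sup>2))\<^sup>2 * (p / 2) = 1 / (72 * p ^ 3)"
      using p by (simp add: divide_simps) (simp add: power_numeral_reduce)
    ultimately show ?thesis using p by simp
  qed
  have "1 / (72 * p ^ 3) \<le> (\<Sum>j<T. (g j)\<^sup>2)"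
  proof (cases "\<exists>i\<in>{1..T}. 1 / 2 \<le> Y i")
    case True
    define k where "k = Max {i\<in>{1..T}. 1 / 2 \<le> Y i}"
    have "k \<in> {i\<in>{1..T}. 1 / 2 \<le> Y i}"
      unfolding k_def by (rule Max_in) (use True in auto)
    then have k: "k \<le> T" "1 / 2 \<le> Y k" by auto
    have "Y i \<le> 1 / 2" if i: "k < i" "i \<le> T" for i
    proof (rule ccontr)
      assume "\<not> Y i \<le> 1 / 2"
      then have "i \<le> k" unfolding k_def by (intro Max_ge) (use i in auto)
      then show False using i by simp
    qed
    moreover have "Y (k + 1) * bump M 0 - Y k * bump M (0 + 1) \<le> - (1 / (6 * p\<^sup>2))"
    proof -
      have "1 / (6 * p\<^sup>2) \<le> 1 / (2 * (M + 1))"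
        using M p by (intro divide_left_mono mult_pos_pos) auto
      also have "\<dots> = 1 / 2 * bump M 1" by (simp add: bump_def)
      also have "\<dots> \<le> Y k * bump M 1"
        using k M by (intro mult_right_mono) (auto simp: bump_def)
      finally show ?thesis by (simp add: bump_def)
    qed
    ultimately show ?thesis using k by (intro *[of k 0]) auto
  next
    case False
    have b: "bump M p = 1 / (2 * p + 1)" "bump M (p + 1) = 1 / (2 * p + 1)"
    proof -
      have "M + p\<^sup>2 = p * (2 * p + 1)" "M + (p + 1)\<^sup>2 = (p + 1) * (2 * p + 1)"
        by (auto simp: M_def power2_eq_square algebra_simps)
      then show "bump M p = 1 / (2 * p + 1)" "bump M (p + 1) = 1 / (2 * p + 1)"
        using p by (auto simp: bump_def)
    qed
    have "1 \<in> {1..T}" using T by simp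
    then have "\<not> 1 / 2 \<le> Y 1" using False by blast
    then have "Y 1 \<le> 1 / 2" by simp
    then have "1 / (2 * p) \<le> 1 / p * (1 - Y 1)" using p by (simp add: field_simps)
    then have "1 / (2 * p) * (1 / (2 * p + 1)) \<le> 1 / p * (1 - Y 1) * (1 / (2 * p + 1))"
      using p by (intro mult_right_mono) auto
    moreover have "1 / (6 * p\<^sup>2) \<le> 1 / (2 * p) * (1 / (2 * p + 1))"
    proof -
      have "2 * p * (2 * p + 1) \<le> 6 * p\<^sup>2"
        using pp by (simp add: power2_eq_square algebra_simps)
      then have "1 / (6 * p\<^sup>2) \<le> 1 / (2 * p * (2 * p + 1))"
        using p by (intro divide_left_mono mult_pos_pos) auto
      then show ?thesis by simp
    qed
    moreover have "Y 1 - Y 0 = - (1 / p * (1 - Y 1))" by (simp add: Y_def)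
    ultimately have "Y (0 + 1) * bump M p - Y 0 * bump M (p + 1) \<le> - (1 / (6 * p\<^sup>2))"
      unfolding b by (simp add: left_diff_distrib[symmetric] diff_divide_distrib[symmetric] del: times_divide_eq_left)
    then show ?thesis using False p by (intro *[of 0 p]) (auto simp: not_le intro: less_imp_le)
  qed
  then show ?thesis by (simp add: g_def M_def)
qed

section \<open>Orthonormal families and gradients\<close>

lemma norm_sum_orthonormal:
  fixes e :: "'i \<Rightarrow> 'a::real_inner"
  assumes "finite S" "\<And>s s'. s \<in> S \<Longrightarrow> s' \<in> S \<Longrightarrow> inner (e s) (e s') = (if s = s' then 1 else 0)"
  shows "(norm (\<Sum>s\<in>S. c s *\<^sub>R e s))\<^sup>2 = (\<Sum>s\<in>S. (c s)\<^sup>2)"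
proof -
  have "(norm (\<Sum>s\<in>S. c s *\<^sub>R e s))\<^sup>2 = (\<Sum>s\<in>S. \<Sum>s'\<in>S. c s * (c s' * inner (e s') (e s)))"
    unfolding power2_norm_eq_inner by (simp add: inner_sum_left inner_sum_right sum_distrib_left)
  also have "\<dots> = (\<Sum>s\<in>S. \<Sum>s'\<in>S. if s = s' then (c s)\<^sup>2 else 0)"
    using assms(2) by (intro sum.cong) (auto simp: power2_eq_square)
  finally show ?thesis using assms(1) by simp
qed

lemma Bessel_inequality:
  fixes e :: "'i \<Rightarrow> 'a::real_inner"
  assumes "finite S" "\<And>s s'. s \<in> S \<Longrightarrow> s' \<in> S \<Longrightarrow> inner (e s) (e s') = (if s = s' then 1 else 0)"
  shows "(\<Sum>s\<in>S. (inner (e s) w)\<^sup>2) \<le> (norm w)\<^sup>2"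
proof -
  let ?v = "\<Sum>s\<in>S. inner (e s) w *\<^sub>R e s"
  have "inner ?v w = (\<Sum>s\<in>S. (inner (e s) w)\<^sup>2)"
    by (simp add: inner_sum_left power2_eq_square)
  moreover have "(norm ?v)\<^sup>2 = (\<Sum>s\<in>S. (inner (e s) w)\<^sup>2)"
    by (rule norm_sum_orthonormal[OF assms])
  moreover have "(norm (w - ?v))\<^sup>2 = (norm w)\<^sup>2 - 2 * inner ?v w + (norm ?v)\<^sup>2"
    by (simp add: power2_norm_eq_inner inner_diff_left inner_diff_right inner_commute)
  ultimately show ?thesis using zero_le_power2[of "norm (w - ?v)"] by linarith
qed

text \<open>
  A quadratic bound on the remainder of the first-order expansion already determines the gradient, so the
  differentiability of the hard functions follows from the estimates that smoothness requires anyway.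
\<close>
lemma has_grad_quadratic_remainder:
  assumes g: "g \<in> Rd d" and z: "z \<in> Rd d"
    and le: "\<And>x. x \<in> Rd d \<Longrightarrow> \<bar>f x - f z - inner g (x - z)\<bar> \<le> C * (norm (x - z))\<^sup>2"
  shows "has_grad d f z g"
proof -
  have "((\<lambda>x. (1 / norm (x - z)) *\<^sub>R (f x - (f z + inner g (x - z)))) \<longlongrightarrow> 0) (at z within Rd d)"
  proof (rule Lim_null_comparison)
    show "\<forall>\<^sub>F x in at z within Rd d.
        norm ((1 / norm (x - z)) *\<^sub>R (f x - (f z + inner g (x - z)))) \<le> C * norm (x - z)"
      unfolding eventually_at_filter
    proof (intro always_eventually allI impI)
      fix x assume x: "x \<noteq> z" "x \<in> Rd d"
      have "norm ((1 / norm (x - z)) *\<^sub>R (f x - (f z + inner g (x - z))))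
          = \<bar>f x - f z - inner g (x - z)\<bar> / norm (x - z)"
        by (simp add: diff_diff_eq)
      also have "\<dots> \<le> C * (norm (x - z))\<^sup>2 / norm (x - z)"
        by (rule divide_right_mono[OF le]) (use x in auto)
      finally show "norm ((1 / norm (x - z)) *\<^sub>R (f x - (f z + inner g (x - z)))) \<le> C * norm (x - z)"
        using x by (simp add: power2_eq_square)
    qed
    have "((\<lambda>x. C * norm (x - z)) \<longlongrightarrow> C * norm (z - z)) (at z within Rd d)"
      by (intro tendsto_intros)
    then show "((\<lambda>x. C * norm (x - z)) \<longlongrightarrow> 0) (at z within Rd d)" by simp
  qed
  then show ?thesis
    using g by (simp add: has_grad_def has_derivative_within bounded_linear_inner_right)
qed

lemma differentiable_on_has_grad:
  "(\<And>x. x \<in> Rd d \<Longrightarrow> has_grad d f x (g x)) \<Longrightarrow> f differentiable_on Rd d"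
  by (auto simp: differentiable_on_def differentiable_def has_grad_def)

section \<open>Chains in orthogonal blocks\<close>

text \<open>
  One chain for each of the \<open>n\<close> functions, in pairwise orthogonal subspaces: the chain of function \<open>i\<close>
  reads the coordinates of a point along \<open>u i 0, \<dots>, u i (T - 1)\<close>, stretched by \<open>\<beta>\<close>.
\<close>
locale chain_family =
  fixes n T d :: nat and u :: "nat \<Rightarrow> nat \<Rightarrow> rvec" and \<theta> \<alpha> lam \<beta> :: real
  assumes n_pos: "1 \<le> n" and T_pos: "0 < T"
    and u_Rd: "\<And>i j. i \<in> {1..n} \<Longrightarrow> j < T \<Longrightarrow> u i j \<in> Rd d"
    and orthonormal: "\<And>i j i' j'. i \<in> {1..n} \<Longrightarrow> j < T \<Longrightarrow> i' \<in> {1..n} \<Longrightarrow> j' < T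
      \<Longrightarrow> inner (u i j) (u i' j') = (if i = i' \<and> j = j' then 1 else 0)"
    and \<theta>_bounds: "0 \<le> \<theta>" "\<theta> \<le> 1" and \<alpha>_bounds: "0 \<le> \<alpha>" "\<alpha> \<le> 4"
    and lam_pos: "0 < lam" and \<beta>_pos: "0 < \<beta>"
begin

definition block :: "nat \<Rightarrow> rvec \<Rightarrow> nat \<Rightarrow> real" where
  "block i x j = (if j < T then inner (u i j) x / \<beta> else 0)"

definition component :: "nat \<Rightarrow> rvec \<Rightarrow> real" where
  "component i x = lam * chain \<theta> \<alpha> T (block i x)"

definition component_grad :: "nat \<Rightarrow> rvec \<Rightarrow> rvec" where
  "component_grad i x = (\<Sum>j<T. (lam / \<beta> * chain_grad \<theta> \<alpha> (block i x) j) *\<^sub>R u i j)"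

definition block_norm2 :: "nat \<Rightarrow> rvec \<Rightarrow> real" where
  "block_norm2 i w = (\<Sum>j<T. (inner (u i j) w)\<^sup>2)"

text \<open>
  The factor by which the rescaling multiplies curvatures.
\<close>
definition K :: real where
  "K = lam / \<beta>\<^sup>2"

lemma K_nonneg: "0 \<le> K"
  using lam_pos by (simp add: K_def)

lemma orthonormal_block:
  "i \<in> {1..n} \<Longrightarrow> j \<in> {..<T} \<Longrightarrow> j' \<in> {..<T} \<Longrightarrow> inner (u i j) (u i j') = (if j = j' then 1 else 0)"
  using orthonormal[of i j i j'] by simp

lemma orthonormal_pairs:
  "s \<in> {1..n} \<times> {..<T} \<Longrightarrow> s' \<in> {1..n} \<times> {..<T}
    \<Longrightarrow> inner (case_prod u s) (case_prod u s') = (if s = s' then 1 else 0)"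
  using orthonormal by (auto split: prod.splits)

lemma sum_block_norm2_le: "(\<Sum>i=1..n. block_norm2 i w) \<le> (norm w)\<^sup>2"
proof -
  have "(\<Sum>i=1..n. block_norm2 i w) = (\<Sum>s\<in>{1..n} \<times> {..<T}. (inner (case_prod u s) w)\<^sup>2)"
    by (simp add: block_norm2_def sum.cartesian_product case_prod_unfold)
  also have "\<dots> \<le> (norm w)\<^sup>2"
    by (rule Bessel_inequality[OF _ orthonormal_pairs]) auto
  finally show ?thesis .
qed

lemma block_norm2_le: "i \<in> {1..n} \<Longrightarrow> block_norm2 i w \<le> (norm w)\<^sup>2"
  unfolding block_norm2_def by (rule Bessel_inequality[OF _ orthonormal_block]) auto

lemma block_norm2_nonneg: "0 \<le> block_norm2 i w"
  unfolding block_norm2_def by (intro sum_nonneg) auto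

lemma block_diff: "j < T \<Longrightarrow> block i x j - block i z j = inner (u i j) (x - z) / \<beta>"
  by (simp add: block_def inner_diff_right diff_divide_distrib)

lemma sum_block_diff: "(\<Sum>j<T. (block i x j - block i z j)\<^sup>2) = block_norm2 i (x - z) / \<beta>\<^sup>2"
  by (simp add: block_diff block_norm2_def sum_divide_distrib power_divide)

lemma component_grad_Rd: "i \<in> {1..n} \<Longrightarrow> component_grad i x \<in> Rd d"
  unfolding component_grad_def
  by (intro subspace_sum subspace_scale subspace_Rd u_Rd) auto

lemma component_remainder:
  "- (K * \<alpha>) / 2 * block_norm2 i (x - z) \<le> component i x - component i z - inner (component_grad i z) (x - z)"
  "component i x - component i z - inner (component_grad i z) (x - z) \<le> 8 * K / 2 * block_norm2 i (x - z)"
proof -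
  let ?R = "chain \<theta> \<alpha> T (block i x) - chain \<theta> \<alpha> T (block i z)
      - (\<Sum>j<T. chain_grad \<theta> \<alpha> (block i z) j * (block i x j - block i z j))"
  have "inner (component_grad i z) (x - z)
      = lam * (\<Sum>j<T. chain_grad \<theta> \<alpha> (block i z) j * (block i x j - block i z j))"
    by (simp add: component_grad_def inner_sum_left sum_distrib_left block_diff mult.assoc)
  then have R: "component i x - component i z - inner (component_grad i z) (x - z) = lam * ?R"
    by (simp add: component_def algebra_simps)
  have "block i x T = 0" "block i z T = 0" by (auto simp: block_def)
  note b = chain_remainder_bounds[of T "block i x" "block i z" \<theta> \<alpha>,
    OF T_pos this \<theta>_bounds \<alpha>_bounds, unfolded sum_block_diff]
  have "lam * (- \<alpha> / 2 * (block_norm2 i (x - z) / \<beta>\<^sup>2)) \<le> lam * ?R"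
    by (rule mult_left_mono[OF b(1)]) (use lam_pos in simp)
  then show "- (K * \<alpha>) / 2 * block_norm2 i (x - z) \<le> component i x - component i z - inner (component_grad i z) (x - z)"
    unfolding R K_def by (simp add: mult_ac)
  have "lam * ?R \<le> lam * (4 * (block_norm2 i (x - z) / \<beta>\<^sup>2))"
    by (rule mult_left_mono[OF b(2)]) (use lam_pos in simp)
  then show "component i x - component i z - inner (component_grad i z) (x - z) \<le> 8 * K / 2 * block_norm2 i (x - z)"
    unfolding R K_def by (simp add: mult_ac)
qed

lemma component_has_grad:
  assumes i: "i \<in> {1..n}" and z: "z \<in> Rd d"
  shows "has_grad d (component i) z (component_grad i z)"
proof (rule has_grad_quadratic_remainder[OF component_grad_Rd[OF i] z])
  fix x assume "x \<in> Rd d"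
  let ?B = "block_norm2 i (x - z)"
  have "K * \<alpha> / 2 * ?B \<le> 4 * K * ?B"
  proof (rule mult_right_mono[OF _ block_norm2_nonneg])
    have "K * \<alpha> \<le> K * 4" by (rule mult_left_mono[OF \<alpha>_bounds(2) K_nonneg])
    then show "K * \<alpha> / 2 \<le> 4 * K" using K_nonneg by simp
  qed
  then have "\<bar>component i x - component i z - inner (component_grad i z) (x - z)\<bar> \<le> 4 * K * ?B"
    using component_remainder[of i x z] by (simp add: abs_le_iff)
  also have "\<dots> \<le> 4 * K * (norm (x - z))\<^sup>2"
    using K_nonneg block_norm2_le[OF i] by (intro mult_left_mono) auto
  finally show "\<bar>component i x - component i z - inner (component_grad i z) (x - z)\<bar>
    \<le> 4 * K * (norm (x - z))\<^sup>2" .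
qed

lemma grad_component: "i \<in> {1..n} \<Longrightarrow> z \<in> Rd d \<Longrightarrow> grad d (component i) z = component_grad i z"
  by (rule grad_eqI[OF _ component_has_grad])

lemma component_differentiable: "i \<in> {1..n} \<Longrightarrow> component i differentiable_on Rd d"
  by (rule differentiable_on_has_grad[OF component_has_grad])

lemma component_grad_lipschitz:
  assumes i: "i \<in> {1..n}"
  shows "(norm (component_grad i x - component_grad i z))\<^sup>2 \<le> (8 * K)\<^sup>2 * block_norm2 i (x - z)"
proof -
  let ?D = "\<lambda>j. chain_grad \<theta> \<alpha> (block i x) j - chain_grad \<theta> \<alpha> (block i z) j"
  have "component_grad i x - component_grad i z = (\<Sum>j<T. (lam / \<beta> * ?D j) *\<^sub>R u i j)"
    by (simp add: component_grad_def sum_subtractf[symmetric] right_diff_distrib diff_divide_distrib scaleR_left_diff_distrib)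
  then have "(norm (component_grad i x - component_grad i z))\<^sup>2 = (\<Sum>j<T. (lam / \<beta> * ?D j)\<^sup>2)"
    by (simp only: norm_sum_orthonormal[OF finite_lessThan orthonormal_block[OF i]])
  also have "\<dots> = (lam / \<beta>)\<^sup>2 * (\<Sum>j<T. (?D j)\<^sup>2)"
    by (simp only: power_mult_distrib sum_distrib_left)
  also have "\<dots> \<le> (lam / \<beta>)\<^sup>2 * (64 * (block_norm2 i (x - z) / \<beta>\<^sup>2))"
    unfolding sum_block_diff[symmetric]
    by (intro mult_left_mono chain_grad_lipschitz \<theta>_bounds \<alpha>_bounds) (auto simp: block_def)
  also have "\<dots> = (8 * K)\<^sup>2 * block_norm2 i (x - z)"
    by (simp add: K_def power2_eq_square)
  finally show ?thesis .
qed

text \<open>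
  The chains live in orthogonal subspaces, so by the inequality of Bessel the \<open>n\<close> gradient differences
  share a single \<open>(norm (x - z))\<^sup>2\<close>. Each function may thus have curvature \<open>sqrt n * L\<close>, not just \<open>L\<close>.
\<close>
lemma component_average_smooth:
  assumes "(8 * K)\<^sup>2 \<le> real n * L\<^sup>2"
  shows "component \<in> average_smooth_class d n L"
  unfolding average_smooth_class_def
proof (intro CollectI conjI ballI component_differentiable)
  fix x z assume x: "x \<in> Rd d" and z: "z \<in> Rd d"
  let ?c = "(8 * K)\<^sup>2"
  have "(\<Sum>i=1..n. (norm (grad d (component i) x - grad d (component i) z))\<^sup>2)
      \<le> (\<Sum>i=1..n. ?c * block_norm2 i (x - z))"
    using x z by (intro sum_mono) (simp only: grad_component component_grad_lipschitz)
  also have "\<dots> \<le> ?c * (norm (x - z))\<^sup>2"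
    unfolding sum_distrib_left[symmetric] by (intro mult_left_mono sum_block_norm2_le) simp
  also have "\<dots> \<le> real n * L\<^sup>2 * (norm (x - z))\<^sup>2"
    using assms by (intro mult_right_mono) auto
  finally show "1 / real n * (\<Sum>i=1..n. (norm (grad d (component i) x - grad d (component i) z))\<^sup>2)
      \<le> L\<^sup>2 * (norm (x - z))\<^sup>2"
    using n_pos by (simp add: field_simps)
qed

definition average_grad :: "rvec \<Rightarrow> rvec" where
  "average_grad x = (1 / real n) *\<^sub>R (\<Sum>i=1..n. component_grad i x)"

text \<open>
  For the same reason all curvatures of the average are \<open>n\<close> times smaller than those of the components.
\<close>
lemma average_remainder:
  "- (K * \<alpha> / real n) / 2 * (norm (x - z))\<^sup>2
    \<le> average n component x - average n component z - inner (average_grad z) (x - z)"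
  "average n component x - average n component z - inner (average_grad z) (x - z)
    \<le> 8 * K / real n / 2 * (norm (x - z))\<^sup>2"
proof -
  let ?R = "\<lambda>i. component i x - component i z - inner (component_grad i z) (x - z)"
  have R: "average n component x - average n component z - inner (average_grad z) (x - z)
      = (\<Sum>i=1..n. ?R i) / real n"
    by (simp add: average_def average_grad_def inner_sum_left sum_subtractf diff_divide_distrib)
  have "- (K * \<alpha>) / 2 * (norm (x - z))\<^sup>2 \<le> - (K * \<alpha>) / 2 * (\<Sum>i=1..n. block_norm2 i (x - z))"
    using K_nonneg \<alpha>_bounds by (intro mult_left_mono_neg sum_block_norm2_le) auto
  also have "\<dots> \<le> (\<Sum>i=1..n. ?R i)"
    unfolding sum_distrib_left by (intro sum_mono component_remainder)
  finally have "- (K * \<alpha>) / 2 * (norm (x - z))\<^sup>2 / real n \<le> (\<Sum>i=1..n. ?R i) / real n"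
    by (rule divide_right_mono) simp
  then show "- (K * \<alpha> / real n) / 2 * (norm (x - z))\<^sup>2
    \<le> average n component x - average n component z - inner (average_grad z) (x - z)"
    unfolding R by (simp add: mult_ac)
  have "(\<Sum>i=1..n. ?R i) \<le> 8 * K / 2 * (\<Sum>i=1..n. block_norm2 i (x - z))"
    unfolding sum_distrib_left by (intro sum_mono component_remainder)
  also have "\<dots> \<le> 8 * K / 2 * (norm (x - z))\<^sup>2"
    using K_nonneg by (intro mult_left_mono sum_block_norm2_le) auto
  finally have "(\<Sum>i=1..n. ?R i) / real n \<le> 8 * K / 2 * (norm (x - z))\<^sup>2 / real n"
    by (rule divide_right_mono) simp
  then show "average n component x - average n component z - inner (average_grad z) (x - z)
    \<le> 8 * K / real n / 2 * (norm (x - z))\<^sup>2"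
    unfolding R by (simp add: mult_ac)
qed

lemma average_has_grad:
  assumes "z \<in> Rd d"
  shows "has_grad d (average n component) z (average_grad z)"
proof (rule has_grad_quadratic_remainder[OF _ assms])
  show "average_grad z \<in> Rd d"
    unfolding average_grad_def
    by (intro subspace_sum subspace_scale subspace_Rd component_grad_Rd)
  fix x assume "x \<in> Rd d"
  let ?a = "K * \<alpha> / real n / 2 * (norm (x - z))\<^sup>2" and ?b = "8 * K / real n / 2 * (norm (x - z))\<^sup>2"
  have "0 \<le> ?a" "0 \<le> ?b" using K_nonneg \<alpha>_bounds by auto
  then have "\<bar>average n component x - average n component z - inner (average_grad z) (x - z)\<bar> \<le> ?a + ?b"
    using average_remainder[of x z] by (intro abs_leI) linarith+
  then show "\<bar>average n component x - average n component z - inner (average_grad z) (x - z)\<bar>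
    \<le> (K * \<alpha> / real n / 2 + 8 * K / real n / 2) * (norm (x - z))\<^sup>2"
    by (simp only: distrib_right)
qed

lemma grad_average: "z \<in> Rd d \<Longrightarrow> grad d (average n component) z = average_grad z"
  by (rule grad_eqI[OF _ average_has_grad])

lemma average_smooth:
  assumes "K * \<alpha> \<le> real n * \<sigma>" "8 * K \<le> real n * L"
  shows "average n component \<in> smooth_class d (- \<sigma>) L"
  unfolding smooth_class_def
proof (intro CollectI conjI ballI)
  show "average n component differentiable_on Rd d"
    by (rule differentiable_on_has_grad[OF average_has_grad])
  fix x z assume x: "x \<in> Rd d" and z: "z \<in> Rd d"
  have "K * \<alpha> / real n / 2 * (norm (x - z))\<^sup>2 \<le> \<sigma> / 2 * (norm (x - z))\<^sup>2"
    using assms n_pos by (intro mult_right_mono divide_right_mono) (auto simp: divide_simps mult_ac)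
  then show "- \<sigma> / 2 * (norm (x - z))\<^sup>2 \<le> average n component x - average n component z
      - inner (grad d (average n component) z) (x - z)"
    using average_remainder(1)[of x z]
    unfolding grad_average[OF z] minus_divide_left[symmetric] mult_minus_left by linarith
  have "8 * K / real n / 2 * (norm (x - z))\<^sup>2 \<le> L / 2 * (norm (x - z))\<^sup>2"
    using assms n_pos by (intro mult_right_mono divide_right_mono) (auto simp: divide_simps mult_ac)
  then show "average n component x - average n component z
      - inner (grad d (average n component) z) (x - z) \<le> L / 2 * (norm (x - z))\<^sup>2"
    using average_remainder(2)[of x z]
    unfolding grad_average[OF z] by linarith
qed

lemma average_nonneg: "0 \<le> average n component x"
  unfolding average_def component_def using lam_pos \<theta>_bounds \<alpha>_bounds
  by (intro mult_nonneg_nonneg sum_nonneg chain_nonneg) auto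

lemma average_start:
  assumes "\<And>i j. i \<in> {1..n} \<Longrightarrow> j < T \<Longrightarrow> inner (u i j) x0 = 0"
  shows "average n component x0 = lam * (\<theta> / 2 + \<alpha> * real T / 4)"
proof -
  have "component i x0 = lam * (\<theta> / 2 + \<alpha> * real T / 4)" if "i \<in> {1..n}" for i
  proof -
    have "block i x0 = (\<lambda>_. 0)" using assms that by (auto simp: block_def)
    then show ?thesis by (simp add: component_def chain_zero)
  qed
  then show ?thesis using n_pos by (simp add: average_def)
qed

lemma norm_average_grad:
  "(norm (average_grad x))\<^sup>2
    = (lam / \<beta>)\<^sup>2 / (real n)\<^sup>2 * (\<Sum>i=1..n. \<Sum>j<T. (chain_grad \<theta> \<alpha> (block i x) j)\<^sup>2)"
proof -
  let ?c = "\<lambda>s. lam / \<beta> * chain_grad \<theta> \<alpha> (block (fst s) x) (snd s)"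
  have "(\<Sum>i=1..n. component_grad i x) = (\<Sum>s\<in>{1..n} \<times> {..<T}. ?c s *\<^sub>R case_prod u s)"
    by (simp add: component_grad_def sum.cartesian_product case_prod_unfold)
  then have "(norm (\<Sum>i=1..n. component_grad i x))\<^sup>2 = (\<Sum>s\<in>{1..n} \<times> {..<T}. (?c s)\<^sup>2)"
    by (simp only: norm_sum_orthonormal[OF _ orthonormal_pairs] finite_cartesian_product finite_atLeastAtMost finite_lessThan)
  also have "\<dots> = (lam / \<beta>)\<^sup>2 * (\<Sum>i=1..n. \<Sum>j<T. (chain_grad \<theta> \<alpha> (block i x) j)\<^sup>2)"
    by (simp only: sum.cartesian_product case_prod_unfold power_mult_distrib sum_distrib_left)
  finally show ?thesis
    by (simp add: average_grad_def power_divide power_mult_distrib)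
qed

text \<open>
  By orthogonality the squared norm is the sum over all chains, and each unfinished chain contributes
  the bound of \<open>chain_grad_large\<close>.
\<close>
lemma norm_average_grad_large:
  assumes p: "1 \<le> p" "\<theta> = 1 / p" "\<alpha> = 8 / (p * (p + 1))"
    and half: "real n / 2 \<le> real (card {i\<in>{1..n}. inner (u i (T - 1)) x = 0})"
  shows "(lam / \<beta>)\<^sup>2 / (144 * real n * p ^ 3) \<le> (norm (average_grad x))\<^sup>2"
proof -
  let ?U = "{i\<in>{1..n}. inner (u i (T - 1)) x = 0}"
  let ?G = "\<lambda>i. \<Sum>j<T. (chain_grad \<theta> \<alpha> (block i x) j)\<^sup>2"
  have "real n / 2 * (1 / (72 * p ^ 3)) \<le> real (card ?U) * (1 / (72 * p ^ 3))"
    using half p by (intro mult_right_mono) auto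
  also have "\<dots> = (\<Sum>i\<in>?U. 1 / (72 * p ^ 3))" by simp
  also have "\<dots> \<le> (\<Sum>i\<in>?U. ?G i)"
  proof (rule sum_mono)
    fix i assume "i \<in> ?U"
    then show "1 / (72 * p ^ 3) \<le> ?G i"
      unfolding p(2,3) by (intro chain_grad_large p T_pos) (auto simp: block_def)
  qed
  also have "\<dots> \<le> (\<Sum>i=1..n. ?G i)"
    by (intro sum_mono2) (auto simp: sum_nonneg)
  finally have "(lam / \<beta>)\<^sup>2 / (real n)\<^sup>2 * (real n / 2 * (1 / (72 * p ^ 3))) \<le> (norm (average_grad x))\<^sup>2"
    unfolding norm_average_grad by (intro mult_left_mono) auto
  then show ?thesis using n_pos p(1) by (simp add: power2_eq_square field_simps)
qed

text \<open>
  A gradient of function \<open>i\<close> reveals at most one new direction, and only in the block of \<open>i\<close>.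
\<close>
lemma component_grad_zero_chain:
  assumes i: "i \<in> {1..n}" and x: "\<And>j. j < T \<Longrightarrow> r \<le> j \<Longrightarrow> inner (u i j) x = 0"
    and i': "i' \<in> {1..n}" and j: "j < T" "i' = i \<Longrightarrow> r < j"
  shows "inner (u i' j) (component_grad i x) = 0"
proof -
  have "chain_grad \<theta> \<alpha> (block i x) j = 0" if "i' = i"
    by (rule chain_grad_zero_chain[of r]) (use x j that in \<open>auto simp: block_def\<close>)
  then have "chain_grad \<theta> \<alpha> (block i x) k * inner (u i' j) (u i k) = 0" if "k < T" for k
    using orthonormal[OF i' j(1) i that] by auto
  then show ?thesis
    unfolding component_grad_def inner_sum_right by (intro sum.neutral) auto
qed

text \<open>
  The points that vanish, in each block, on all directions from the number of calls to this block on
  form a subspace which grows with time and contains every gradient seen so far. Hence it contains the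
  next point as well, for any choice of the indices, and the conclusion holds for each single trajectory.
\<close>
lemma zero_chain_trajectory:
  fixes s :: "nat \<Rightarrow> rvec \<times> nat"
  assumes s: "\<And>t. fst (s t) \<in> Rd d" "\<And>t. snd (s t) \<in> {1..n}"
    and start: "\<And>i j. i \<in> {1..n} \<Longrightarrow> j < T \<Longrightarrow> inner (u i j) (fst (s 0)) = 0"
    and span: "\<And>t. fst (s (Suc t)) \<in> span ((\<lambda>k. fst (s k)) ` {..t} \<union>
                 (\<lambda>k. grad d (component (snd (s k))) (fst (s k))) ` {..t})"
    and i: "i \<in> {1..n}" and j: "card {k. k < t \<and> snd (s k) = i} \<le> j" "j < T"
  shows "inner (u i j) (fst (s t)) = 0"
proof -
  define c where "c t i = card {k. k < t \<and> snd (s k) = i}" for t i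
  have mono: "c t i \<le> c t' i" if "t \<le> t'" for t t' i
    unfolding c_def using that by (intro card_mono) auto
  have c_Suc: "c (Suc t) (snd (s t)) = Suc (c t (snd (s t)))" for t
  proof -
    have "{k. k < Suc t \<and> snd (s k) = snd (s t)} = insert t {k. k < t \<and> snd (s k) = snd (s t)}"
      by auto
    then show ?thesis by (simp add: c_def)
  qed
  define P where "P t = {x. \<forall>i\<in>{1..n}. \<forall>j<T. c t i \<le> j \<longrightarrow> inner (u i j) x = 0}" for t
  have sub: "subspace (P t)" for t
    by (auto simp: subspace_def P_def inner_add_right)
  have P_mono: "P t \<subseteq> P t'" if "t \<le> t'" for t t'
    using mono[OF that] by (auto simp: P_def intro: order_trans)
  have "fst (s t) \<in> P t" for t
  proof (induction t rule: less_induct)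
    case (less t)
    show ?case
    proof (cases t)
      case 0
      then show ?thesis using start by (simp add: P_def)
    next
      case (Suc t')
      have "(\<lambda>k. fst (s k)) ` {..t'} \<union> (\<lambda>k. grad d (component (snd (s k))) (fst (s k))) ` {..t'} \<subseteq> P t"
      proof (intro Un_least image_subsetI)
        fix k assume "k \<in> {..t'}"
        then have k: "k < t" "Suc k \<le> t" using Suc by auto
        have Pk: "fst (s k) \<in> P k" by (rule less.IH[OF k(1)])
        then show "fst (s k) \<in> P t" using P_mono[of k t] k by auto
        let ?i = "snd (s k)"
        have "inner (u i j) (component_grad ?i (fst (s k))) = 0"
          if "i \<in> {1..n}" "j < T" "c (Suc k) i \<le> j" for i j
        proof (rule component_grad_zero_chain[of ?i "c k ?i"])
          show "i = ?i \<Longrightarrow> c k ?i < j" using that c_Suc[of k] by auto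
        qed (use s(2)[of k] that Pk in \<open>auto simp: P_def\<close>)
        then have "component_grad ?i (fst (s k)) \<in> P (Suc k)" by (simp add: P_def)
        then show "grad d (component ?i) (fst (s k)) \<in> P t"
          using P_mono[OF k(2)] grad_component[OF s(2) s(1)] by auto
      qed
      then have "span ((\<lambda>k. fst (s k)) ` {..t'} \<union> (\<lambda>k. grad d (component (snd (s k))) (fst (s k))) ` {..t'}) \<subseteq> P t"
        by (rule span_minimal[OF _ sub])
      then show ?thesis using span[of t'] Suc by auto
    qed
  qed
  from this[of t] show ?thesis using i j by (auto simp: P_def c_def)
qed

end

text \<open>
  The numbers of calls add up to at most \<open>t\<close>, so fewer than half of the indices can be called \<open>T\<close> times.
\<close>
lemma many_rarely_called:
  fixes \<iota> :: "nat \<Rightarrow> nat"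
  assumes "real t < real n * real T / 2"
  shows "real n / 2 \<le> real (card {i\<in>{1..n}. card {k. k < t \<and> \<iota> k = i} < T})"
proof -
  define c where "c i = card {k. k < t \<and> \<iota> k = i}" for i
  let ?B = "{i\<in>{1..n}. T \<le> c i}" and ?U = "{i\<in>{1..n}. c i < T}"
  have "card ?B * T = (\<Sum>i\<in>?B. T)" by simp
  also have "\<dots> \<le> (\<Sum>i\<in>?B. c i)" by (intro sum_mono) auto
  also have "\<dots> = card (\<Union>i\<in>?B. {k. k < t \<and> \<iota> k = i})"
    unfolding c_def by (subst card_UN_disjoint) auto
  also have "\<dots> \<le> card {..<t}" by (intro card_mono) auto
  finally have "real (card ?B) * real T \<le> real t" by (simp flip: of_nat_mult)
  with assms have "real (card ?B) * real T < real n / 2 * real T" by simp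
  then have "real (card ?B) < real n / 2" by (rule mult_right_less_imp_less) simp
  moreover have "card ?B + card ?U = n"
  proof -
    have "card ?B + card ?U = card (?B \<union> ?U)" by (rule card_Un_disjoint[symmetric]) auto
    also have "?B \<union> ?U = {1..n}" by auto
    finally show ?thesis by simp
  qed
  then have "real (card ?B) + real (card ?U) = real n" by (simp flip: of_nat_add)
  ultimately show ?thesis by (simp add: c_def)
qed

section \<open>Directions orthogonal to the initial point\<close>

text \<open>
  The span condition lets an algorithm move along its initial point \<open>x\<close> for free. The chains
  therefore have to use directions orthogonal to \<open>x\<close>; one spare dimension provides them, namely the images of the first \<open>m\<close> basis
  vectors under the Householder reflection that exchanges the last basis vector with the direction of \<open>x\<close>.
\<close>
lemma orthonormal_directions:
  assumes x: "x \<in> Rd (Suc m)"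
  obtains v where "\<And>k. k < m \<Longrightarrow> v k \<in> Rd (Suc m)"
    "\<And>k l. k < m \<Longrightarrow> l < m \<Longrightarrow> inner (v k) (v l) = (if k = l then 1 else 0)"
    "\<And>k. k < m \<Longrightarrow> inner (v k) x = 0"
proof -
  define e where "e k = vec_of (\<lambda>j. if j = k then 1 else 0)" for k :: nat
  have e: "coord (e k) j = (if j = k then 1 else 0)" for k j
    unfolding e_def by (subst vec_of_inverse) auto
  have inner_e: "inner (e k) y = coord y k" for k y
    by (subst inner_rvec_superset[of "{k}"]) (auto simp: e)
  have e_Rd: "e k \<in> Rd (Suc m)" if "k \<le> m" for k
    using that by (auto simp: Rd_def e)
  define w where "w = (if x = 0 then e m else x /\<^sub>R norm x)"
  have norm_w: "inner w w = 1"
  proof (cases "x = 0")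
    case True
    then show ?thesis by (simp add: w_def inner_e e)
  next
    case False
    then show ?thesis by (simp add: w_def power2_norm_eq_inner[symmetric] power2_eq_square[symmetric])
  qed
  have w_Rd: "w \<in> Rd (Suc m)"
    using x e_Rd subspace_Rd[of "Suc m"] by (auto simp: w_def intro: subspace_scale)
  have x_w: "x = norm x *\<^sub>R w" by (simp add: w_def)
  define h where "h = w - e m"
  \<comment> \<open>The images of the basis vectors under the reflection. If \<open>h = 0\<close> the quotient is \<open>0\<close> and the
    reflection is the identity, as it should be.\<close>
  define v where "v k = e k - (2 * inner h (e k) / inner h h) *\<^sub>R h" for k
  have h_w: "inner h h = 2 * inner h w"
    using norm_w by (simp add: h_def inner_diff_left inner_diff_right inner_commute inner_e e)
  show thesis
  proof
    fix k assume k: "k < m"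
    show "v k \<in> Rd (Suc m)"
      unfolding v_def h_def using k w_Rd
      by (intro subspace_diff subspace_scale subspace_Rd e_Rd) auto
    have "inner (v k) w = inner (e k) (e m)"
    proof (cases "h = 0")
      case True
      then show ?thesis by (simp add: v_def h_def)
    next
      case False
      then have "inner h h \<noteq> 0" by simp
      then have "inner (v k) w = inner (e k) w - inner h (e k)"
        using h_w by (simp add: v_def inner_diff_left)
      then show ?thesis by (simp add: h_def inner_diff_left inner_diff_right inner_commute)
    qed
    then have "inner (v k) w = 0" using k by (simp add: inner_e e)
    then show "inner (v k) x = 0" by (subst x_w) simp
    fix l assume "l < m"
    have "inner (v k) (v l) = inner (e k) (e l)"
    proof (cases "h = 0")
      case False
      then have "inner h h \<noteq> 0" by simp
      then show ?thesis
        by (simp add: v_def inner_diff_left inner_diff_right inner_commute field_simps)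
    qed (simp add: v_def)
    then show "inner (v k) (v l) = (if k = l then 1 else 0)" by (auto simp: inner_e e)
  qed
qed

lemma orthonormal_blocks:
  assumes x: "x \<in> Rd (Suc (n * T))"
  obtains u where
    "\<And>i j. i \<in> {1..n} \<Longrightarrow> j < T \<Longrightarrow> u i j \<in> Rd (Suc (n * T))"
    "\<And>i j i' j'. i \<in> {1..n} \<Longrightarrow> j < T \<Longrightarrow> i' \<in> {1..n} \<Longrightarrow> j' < T
      \<Longrightarrow> inner (u i j) (u i' j') = (if i = i' \<and> j = j' then 1 else 0)"
    "\<And>i j. i \<in> {1..n} \<Longrightarrow> j < T \<Longrightarrow> inner (u i j) x = 0"
proof -
  obtain v where v: "\<And>k. k < n * T \<Longrightarrow> v k \<in> Rd (Suc (n * T))"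
    "\<And>k l. k < n * T \<Longrightarrow> l < n * T \<Longrightarrow> inner (v k) (v l) = (if k = l then 1 else 0)"
    "\<And>k. k < n * T \<Longrightarrow> inner (v k) x = 0"
    using orthonormal_directions[OF x] by blast
  define c where "c i j = (i - 1) * T + j" for i j :: nat
  have c_less: "c i j < n * T" if "i \<in> {1..n}" "j < T" for i j
  proof -
    have "c i j < (i - 1) * T + T" using that by (simp add: c_def)
    also have "\<dots> = i * T" using that by (cases i) auto
    also have "\<dots> \<le> n * T" using that by (intro mult_right_mono) auto
    finally show ?thesis .
  qed
  have c_inj: "c i j = c i' j' \<longleftrightarrow> i = i' \<and> j = j'"
    if "i \<in> {1..n}" "j < T" "i' \<in> {1..n}" "j' < T" for i j i' j'
  proof
    assume eq: "c i j = c i' j'"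
    have "c i j div T = i - 1" "c i j mod T = j" "c i' j' div T = i' - 1" "c i' j' mod T = j'"
      using that by (auto simp: c_def)
    then show "i = i' \<and> j = j'" using eq that by auto
  qed auto
  show thesis
    by (rule that[of "\<lambda>i j. v (c i j)"]) (use v c_less c_inj in auto)
qed

section \<open>The lower bound\<close>

lemma not_expected_grad_norm_le:
  assumes P: "P \<in> space (prob_algebra M)" and "0 \<le> \<epsilon>" "\<epsilon> < a"
    and ae: "AE s in P. a \<le> norm (grad d F (fst (s t)))"
  shows "\<not> expected_grad_norm d F P t \<le> ennreal \<epsilon>"
proof -
  interpret prob_space P using P by (simp add: space_prob_algebra)
  have "ennreal a = (\<integral>\<^sup>+ s. ennreal a \<partial>P)" by (simp add: emeasure_space_1)
  also have "\<dots> \<le> expected_grad_norm d F P t"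
    unfolding expected_grad_norm_def
    by (rule nn_integral_mono_AE) (use ae in \<open>auto simp: ennreal_leI\<close>)
  finally have "ennreal a \<le> expected_grad_norm d F P t" .
  moreover have "ennreal \<epsilon> < ennreal a" using assms by (simp add: ennreal_less_iff)
  ultimately show ?thesis by (simp add: not_le)
qed

text \<open>
  The scale \<open>p\<close> is, up to a constant, the number of nodes over which a chain can descend most gently. Longer descents have flatter wells, and
  \<open>p\<^sup>2\<close> is chosen as the ratio \<open>L / (sqrt n * \<sigma>)\<close> of the admissible upper and lower curvatures, unless this is
  below \<open>1\<close>. These two cases are the two arguments of the minimum in the complexity.
\<close>
lemma parameter_choice:
  fixes n :: nat
  assumes n: "1 \<le> n" and pos: "0 < L" "0 < \<sigma>" "0 < \<Delta>" "0 < \<epsilon>"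
    and \<epsilon>: "\<epsilon>\<^sup>2 \<le> min (\<Delta> * \<sigma>) (L * \<Delta> * real n powr (- 1/2)) / 10 ^ 5"
  obtains p where "1 \<le> p" "sqrt (real n) * L \<le> real n * \<sigma> * p\<^sup>2"
    "10 ^ 5 * (sqrt (real n) * p\<^sup>2 * \<epsilon>\<^sup>2) \<le> L * \<Delta>"
    "complexity n L \<sigma> \<Delta> \<epsilon> = \<Delta> / \<epsilon>\<^sup>2 * (sqrt (real n) * L / p)"
proof -
  define s where "s = sqrt (real n)"
  have s: "1 \<le> s" "s * s = real n" using n by (auto simp: s_def)
  have powr: "real n powr (- 1/2) = 1 / s" "real n powr (3/4) = s * sqrt s"
  proof -
    have h: "s = real n powr (1/2)" using n by (simp add: s_def powr_half_sqrt)
    then have q: "sqrt s = real n powr (1/4)" using s by (simp add: powr_half_sqrt[symmetric] powr_powr)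
    show "real n powr (- 1/2) = 1 / s" using h n by (simp add: powr_minus_divide)
    show "real n powr (3/4) = s * sqrt s" unfolding q unfolding h by (simp flip: powr_add)
  qed
  define A where "A = s * sqrt (s * \<sigma> * L)"
  have complexity: "complexity n L \<sigma> \<Delta> \<epsilon> = \<Delta> / \<epsilon>\<^sup>2 * min A (s * L)"
    by (simp add: complexity_def powr A_def s_def real_sqrt_mult mult.assoc)
  have \<epsilon>1: "10 ^ 5 * \<epsilon>\<^sup>2 \<le> \<Delta> * \<sigma>" and \<epsilon>2: "10 ^ 5 * \<epsilon>\<^sup>2 \<le> L * \<Delta> / s"
    using \<epsilon> unfolding powr by auto
  show thesis
  proof (cases "L \<le> s * \<sigma>")
    case True
    have "L = sqrt (L * L)" using pos by simp
    also have "\<dots> \<le> sqrt (s * \<sigma> * L)" using True pos by (intro real_sqrt_le_mono mult_right_mono) auto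
    finally have "s * L \<le> A" unfolding A_def using s by (intro mult_left_mono) auto
    then show thesis
      using True s pos \<epsilon>2 mult_left_mono[OF True, of s]
      by (intro that[of 1]) (auto simp: complexity min_def s_def[symmetric] field_simps)
  next
    case False
    define p where "p = sqrt (L / (s * \<sigma>))"
    have s\<sigma>: "0 < s * \<sigma>" using s pos by simp
    have p: "1 \<le> p" using False s\<sigma> by (simp add: p_def)
    have p2: "s * \<sigma> * p\<^sup>2 = L" using s pos by (simp add: p_def)
    have "sqrt (s * \<sigma> * L) * p = sqrt (s * \<sigma> * L * (L / (s * \<sigma>)))"
      unfolding p_def by (rule real_sqrt_mult[symmetric])
    also have "s * \<sigma> * L * (L / (s * \<sigma>)) = L\<^sup>2" using s\<sigma> s pos by (simp add: power2_eq_square)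
    finally have "A * p = s * L" using pos by (simp add: A_def)
    then have A: "A = s * L / p" using p by (simp add: field_simps)
    moreover have "s * L / p \<le> s * L"
      using p s pos mult_left_mono[of 1 p "s * L"] by (simp add: divide_le_eq)
    ultimately have "complexity n L \<sigma> \<Delta> \<epsilon> = \<Delta> / \<epsilon>\<^sup>2 * (s * L / p)"
      by (simp add: complexity min_def)
    moreover have "10 ^ 5 * (s * p\<^sup>2 * \<epsilon>\<^sup>2) \<le> L * \<Delta>"
    proof -
      have "s * p\<^sup>2 * (10 ^ 5 * \<epsilon>\<^sup>2) \<le> s * p\<^sup>2 * (\<Delta> * \<sigma>)"
        using \<epsilon>1 s by (intro mult_left_mono) auto
      then show ?thesis unfolding p2[symmetric] by (simp add: mult_ac)
    qed
    moreover have "s * L = real n * \<sigma> * p\<^sup>2"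
      unfolding p2[symmetric] s(2)[symmetric] by (simp add: mult_ac)
    ultimately show thesis using p by (intro that[of p]) (auto simp: s_def)
  qed
qed

lemma average_smooth_classD: "f \<in> average_smooth_class d n L \<Longrightarrow> \<forall>i\<in>{1..n}. f i differentiable_on Rd d"
  by (simp add: average_smooth_class_def)

theorem theorem4p5:
  shows "\<exists>c>0. \<exists>C>0.
    \<forall>(n::nat) (L::real) (\<sigma>::real) (\<Delta>::real) (\<epsilon>::real) x0 \<F> A.
      n \<ge> 1 \<longrightarrow> L > 0 \<longrightarrow> \<sigma> > 0 \<longrightarrow> \<Delta> > 0 \<longrightarrow> \<epsilon> > 0 \<longrightarrow>
      \<epsilon>\<^sup>2 \<le> min (\<Delta> * \<sigma>) (L * \<Delta> * real n powr (- 1/2)) / 10 ^ 5 \<longrightarrow>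
      linear_span_algorithm n x0 \<F> A \<longrightarrow>
      (\<exists>d\<ge>1. real d \<le> C * complexity n L \<sigma> \<Delta> \<epsilon> \<and>
        (\<exists>f. f \<in> average_smooth_class d n L \<and>
             average n f \<in> smooth_class d (- \<sigma>) L \<and>
             bdd_below (average n f ` Rd d) \<and>
             average n f (x0 d) - (INF x\<in>Rd d. average n f x) \<le> \<Delta> \<and>
             needs_at_least d (average n f) (A d f) \<epsilon> (c * complexity n L \<sigma> \<Delta> \<epsilon>)))"
proof (rule exI[of _ "1 / 25600"], rule conjI, simp, rule exI[of _ 1], rule conjI, simp, intro allI impI)
  fix n :: nat and L \<sigma> \<Delta> \<epsilon> :: real and x0 \<F> A
  assume n: "n \<ge> 1" and pos: "0 < L" "0 < \<sigma>" "0 < \<Delta>" "0 < \<epsilon>"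
    and \<epsilon>: "\<epsilon>\<^sup>2 \<le> min (\<Delta> * \<sigma>) (L * \<Delta> * real n powr (- 1/2)) / 10 ^ 5"
    and alg: "linear_span_algorithm n x0 \<F> A"
  define s where "s = sqrt (real n)"
  have s: "1 \<le> s" "s * s = real n" using n by (auto simp: s_def)
  obtain p where p: "1 \<le> p" and p\<sigma>: "s * L \<le> real n * \<sigma> * p\<^sup>2"
    and p\<epsilon>: "10 ^ 5 * (s * p\<^sup>2 * \<epsilon>\<^sup>2) \<le> L * \<Delta>"
    and complexity: "complexity n L \<sigma> \<Delta> \<epsilon> = \<Delta> / \<epsilon>\<^sup>2 * (s * L / p)"
    unfolding s_def using parameter_choice[OF n pos \<epsilon>] by blast
  \<comment> \<open>The complexity per function. A chain of length \<open>X / 6400\<close> uses up at most half of the admissible gap \<open>\<Delta>\<close>.\<close>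
  define X where "X = L * \<Delta> / (s * p * \<epsilon>\<^sup>2)"
  have cX: "complexity n L \<sigma> \<Delta> \<epsilon> = real n * X"
    unfolding complexity X_def s(2)[symmetric] using s(1) by (simp add: field_simps)
  have spe: "0 < s * p * \<epsilon>\<^sup>2" using s p pos by simp
  \<comment> \<open>This makes rounding the length of the chain harmless.\<close>
  have X: "10 ^ 5 \<le> X"
  proof -
    have "10 ^ 5 * (s * p * \<epsilon>\<^sup>2) * 1 \<le> 10 ^ 5 * (s * p * \<epsilon>\<^sup>2) * p"
      using p spe by (intro mult_left_mono) auto
    also have "\<dots> \<le> L * \<Delta>" using p\<epsilon> by (simp add: power2_eq_square mult_ac)
    finally show ?thesis unfolding X_def using spe by (subst pos_le_divide_eq) auto
  qed
  define T where "T = nat \<lfloor>X / 6400\<rfloor>"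
  have T: "real T \<le> X / 6400" "X / 12800 \<le> real T" "0 < T"
  proof -
    have eq: "real T = of_int \<lfloor>X / 6400\<rfloor>" using X by (simp add: T_def)
    have "100000 \<le> X" using X by simp
    then show "real T \<le> X / 6400" "X / 12800 \<le> real T"
      unfolding eq using real_of_int_floor_gt_diff_one[of "X / 6400"] of_int_floor_le[of "X / 6400"]
      by linarith+
    then have "0 < real T" using \<open>100000 \<le> X\<close> by linarith
    then show "0 < T" by simp
  qed
  define d where "d = Suc (n * T)"
  have d: "1 \<le> d" by (simp add: d_def)
  have algorithm: "x0 d \<in> Rd d" "space (\<F> d) = {f. \<forall>i\<in>{1..n}. f i differentiable_on Rd d}"
    "A d \<in> \<F> d \<rightarrow>\<^sub>M prob_algebra (trajectories n d)"
    "\<forall>f\<in>space (\<F> d). AE s in A d f. fst (s 0) = x0 d \<and>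
        (\<forall>t. fst (s (Suc t)) \<in> span ((\<lambda>j. fst (s j)) ` {..t} \<union>
             (\<lambda>j. grad d (f (snd (s j))) (fst (s j))) ` {..t}))"
    using alg d unfolding linear_span_algorithm_def by blast+
  from algorithm(1) obtain u where u: "\<And>i j. i \<in> {1..n} \<Longrightarrow> j < T \<Longrightarrow> u i j \<in> Rd d"
    "\<And>i j i' j'. i \<in> {1..n} \<Longrightarrow> j < T \<Longrightarrow> i' \<in> {1..n} \<Longrightarrow> j' < T
      \<Longrightarrow> inner (u i j) (u i' j') = (if i = i' \<and> j = j' then 1 else 0)"
    "\<And>i j. i \<in> {1..n} \<Longrightarrow> j < T \<Longrightarrow> inner (u i j) (x0 d) = 0"
    unfolding d_def using orthonormal_blocks[of "x0 (Suc (n * T))" n T] by blast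
  \<comment> \<open>The curvature \<open>8 * \<kappa>\<close> of each component is the largest that average smoothness admits.\<close>
  define \<kappa> where "\<kappa> = s * L / 8"
  have \<kappa>: "0 < \<kappa>" using s pos by (simp add: \<kappa>_def)
  \<comment> \<open>The stretching for which an average with half of its chains unfinished has a gradient
    of squared norm at least \<open>200 / 144 * \<epsilon>\<^sup>2\<close>.\<close>
  define \<beta> where "\<beta> = sqrt (200 * real n * p ^ 3 * \<epsilon>\<^sup>2) / \<kappa>"
  have \<beta>: "0 < \<beta>" "\<beta>\<^sup>2 = 200 * real n * p ^ 3 * \<epsilon>\<^sup>2 / \<kappa>\<^sup>2"
    using n p pos \<kappa> by (auto simp: \<beta>_def power_divide)
  define lam where "lam = \<kappa> * \<beta>\<^sup>2"
  have lam_gt: "0 < lam" using \<kappa> \<beta>(1) unfolding lam_def by (intro mult_pos_pos) auto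
  define \<alpha> where "\<alpha> = 8 / (p * (p + 1))"
  have pp: "p\<^sup>2 \<le> p * (p + 1)" "1 \<le> p * p" "2 \<le> p * (p + 1)"
    using p mult_mono[of 1 p 1 p] by (auto simp: power2_eq_square algebra_simps)
  have \<alpha>: "0 \<le> \<alpha>" "\<alpha> \<le> 4" "\<alpha> \<le> 8 / p\<^sup>2"
  proof -
    show "0 \<le> \<alpha>" "\<alpha> \<le> 4" unfolding \<alpha>_def using p pp by (auto simp: divide_le_eq)
    show "\<alpha> \<le> 8 / p\<^sup>2" unfolding \<alpha>_def using p pp by (intro divide_left_mono mult_pos_pos) auto
  qed
  interpret chain_family n T d u "1 / p" \<alpha> lam \<beta>
    by unfold_locales (use n T u p \<alpha> lam_gt \<beta>(1) in auto)
  have K: "K = \<kappa>" using \<beta>(1) by (simp add: K_def) (simp add: lam_def)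
  have average_smooth_component: "component \<in> average_smooth_class d n L"
    by (rule component_average_smooth) (simp add: K \<kappa>_def power_mult_distrib s_def)
  have smooth: "average n component \<in> smooth_class d (- \<sigma>) L"
  proof (rule average_smooth)
    have "\<kappa> * \<alpha> \<le> \<kappa> * (8 / p\<^sup>2)" using \<alpha> \<kappa> by (intro mult_left_mono) auto
    also have "\<dots> = s * L / p\<^sup>2" by (simp add: \<kappa>_def)
    also have "\<dots> \<le> real n * \<sigma>" using p\<sigma> p by (simp add: divide_le_eq)
    finally show "K * \<alpha> \<le> real n * \<sigma>" by (simp add: K)
    have "1 * s \<le> s * s" using s by (intro mult_right_mono) auto
    then have "s \<le> real n" by (simp add: s)
    then show "8 * K \<le> real n * L" using pos by (simp add: K \<kappa>_def)
  qed
  have bdd: "bdd_below (average n component ` Rd d)"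
    by (rule bdd_belowI2[of _ 0]) (rule average_nonneg)
  have gap: "average n component (x0 d) - (INF x\<in>Rd d. average n component x) \<le> \<Delta>"
  proof -
    have lam: "lam = 1600 * s * p ^ 3 * \<epsilon>\<^sup>2 / L"
      unfolding lam_def \<beta>(2) unfolding \<kappa>_def s(2)[symmetric] using s(1) pos
      by (simp add: field_simps power2_eq_square)
    have "0 \<le> (INF x\<in>Rd d. average n component x)"
      using algorithm(1) by (intro cINF_greatest average_nonneg) auto
    moreover have "average n component (x0 d) = lam * (1 / p / 2 + \<alpha> * real T / 4)"
      by (rule average_start) (rule u(3))
    \<comment> \<open>The front springs store a height that does not depend on \<open>T\<close>. It fits into the gap because
      \<open>\<epsilon>\<^sup>2\<close> is small compared with \<open>\<Delta> * \<sigma>\<close> and \<open>L * \<Delta> / sqrt n\<close>.\<close>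
    moreover have "lam * (1 / p / 2) \<le> \<Delta> / 2"
    proof -
      have "lam * (1 / p / 2) = 800 * (s * p\<^sup>2 * \<epsilon>\<^sup>2) / L"
        using p by (simp add: lam power2_eq_square power3_eq_cube)
      also have "\<dots> \<le> \<Delta> / 2"
      proof -
        have "0 \<le> s * p\<^sup>2 * \<epsilon>\<^sup>2" using s by simp
        then have "800 * (s * p\<^sup>2 * \<epsilon>\<^sup>2) \<le> L * \<Delta> / 2" using p\<epsilon> by simp
        then show ?thesis using pos by (simp add: divide_le_eq mult.commute)
      qed
      finally show ?thesis .
    qed
    moreover have "lam * (\<alpha> * real T / 4) \<le> \<Delta> / 2"
    proof -
      have "lam * (\<alpha> * real T / 4) \<le> lam * (8 / p\<^sup>2 * (X / 6400) / 4)"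
        using T \<alpha> lam_pos by (intro mult_left_mono divide_right_mono mult_mono) auto
      also have "\<dots> = \<Delta> / 2"
        using p s(1) pos by (simp add: lam X_def power2_eq_square power3_eq_cube field_simps)
      finally show ?thesis .
    qed
    ultimately show ?thesis unfolding distrib_left by linarith
  qed
  have large: "11 / 10 * \<epsilon> \<le> norm (average_grad x)"
    if "real n / 2 \<le> real (card {i\<in>{1..n}. inner (u i (T - 1)) x = 0})" for x
  proof -
    have "(11 / 10 * \<epsilon>)\<^sup>2 \<le> 200 / 144 * \<epsilon>\<^sup>2" by (simp add: power_mult_distrib power_divide)
    also have "\<dots> = (lam / \<beta>)\<^sup>2 / (144 * real n * p ^ 3)"
    proof -
      have "lam / \<beta> = \<kappa> * \<beta>" using \<beta>(1) by (simp add: lam_def power2_eq_square)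
      then have "(lam / \<beta>)\<^sup>2 = 200 * real n * p ^ 3 * \<epsilon>\<^sup>2"
        using \<kappa> by (simp add: power_mult_distrib \<beta>(2))
      then show ?thesis using n p by simp
    qed
    also have "\<dots> \<le> (norm (average_grad x))\<^sup>2"
      by (rule norm_average_grad_large[OF p refl \<alpha>_def that])
    finally show ?thesis by (rule power2_le_imp_le) simp
  qed
  have needs: "needs_at_least d (average n component) (A d component) \<epsilon> (1 / 25600 * (real n * X))"
    unfolding needs_at_least_def
  proof (intro allI impI)
    fix t assume t: "real t < 1 / 25600 * (real n * X)"
    have "real n * (X / 12800) \<le> real n * real T" using T by (intro mult_left_mono) auto
    then have "real t < real n * real T / 2" using t by simp
    note few = many_rarely_called[OF this]
    have f: "component \<in> space (\<F> d)"
      using algorithm(2) average_smooth_classD[OF average_smooth_component] by blast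
    have P: "A d component \<in> space (prob_algebra (trajectories n d))"
      by (rule measurable_space[OF algorithm(3) f])
    note ae = bspec[OF algorithm(4) f]
    have "space (A d component) = space (trajectories n d)"
      using P by (intro sets_eq_imp_space_eq) (simp add: space_prob_algebra)
    then have range: "fst (s k) \<in> Rd d" "snd (s k) \<in> {1..n}" if "s \<in> space (A d component)" for s k
      using that
      by (auto simp: trajectories_def space_PiM space_pair_measure space_restrict_space PiE_iff mem_Times_iff)
    show "\<not> expected_grad_norm d (average n component) (A d component) t \<le> ennreal \<epsilon>"
    proof (rule not_expected_grad_norm_le[OF P])
      show "AE s in A d component. 11 / 10 * \<epsilon> \<le> norm (grad d (average n component) (fst (s t)))"
        using ae AE_space
      proof eventually_elim
        case (elim s)
        have "inner (u i (T - 1)) (fst (s t)) = 0"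
          if "i \<in> {1..n}" "card {k. k < t \<and> snd (s k) = i} < T" for i
        proof (rule zero_chain_trajectory)
          show "fst (s k) \<in> Rd d" "snd (s k) \<in> {1..n}" for k
            by (rule range[OF elim(2)])+
          show "inner (u i j) (fst (s 0)) = 0" if "i \<in> {1..n}" "j < T" for i j
            using u(3)[OF that] elim(1) by simp
          show "fst (s (Suc k)) \<in> span ((\<lambda>j. fst (s j)) ` {..k} \<union>
             (\<lambda>j. grad d (component (snd (s j))) (fst (s j))) ` {..k})" for k
            using elim(1) by blast
          show "card {k. k < t \<and> snd (s k) = i} \<le> T - 1" "T - 1 < T" using that T by auto
        qed (rule that)
        then have "real (card {i\<in>{1..n}. card {k. k < t \<and> snd (s k) = i} < T})
            \<le> real (card {i\<in>{1..n}. inner (u i (T - 1)) (fst (s t)) = 0})"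
          by (intro of_nat_mono card_mono) auto
        with few[of "\<lambda>k. snd (s k)"] have "11 / 10 * \<epsilon> \<le> norm (average_grad (fst (s t)))"
          by (intro large) linarith
        then show ?case using range(1)[OF elim(2)] by (simp add: grad_average)
      qed
    qed (use pos in auto)
  qed
  have "real d \<le> 1 * complexity n L \<sigma> \<Delta> \<epsilon>"
  proof -
    have "real n * real T \<le> real n * (X / 6400)" using T by (intro mult_left_mono) auto
    moreover have "1 * X \<le> real n * X" using n X by (intro mult_right_mono) auto
    moreover have "100000 \<le> X" using X by simp
    ultimately show ?thesis unfolding cX d_def of_nat_Suc of_nat_mult by linarith
  qed
  then show "\<exists>d\<ge>1. real d \<le> 1 * complexity n L \<sigma> \<Delta> \<epsilon> \<and>
        (\<exists>f. f \<in> average_smooth_class d n L \<and>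
             average n f \<in> smooth_class d (- \<sigma>) L \<and>
             bdd_below (average n f ` Rd d) \<and>
             average n f (x0 d) - (INF x\<in>Rd d. average n f x) \<le> \<Delta> \<and>
             needs_at_least d (average n f) (A d f) \<epsilon> (1 / 25600 * complexity n L \<sigma> \<Delta> \<epsilon>))"
    unfolding cX using d average_smooth_component smooth bdd gap needs by blast
qed

end
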